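(* Let $D,D'$ be Prüfer domains such that there is a homeomorphism $\phi:\operatorname{Spec}(D)\longrightarrow\operatorname{Spec}(D')$. Then $\phi(\operatorname{Spec}^\ast(D))=\operatorname{Spec}^\ast(D')$.
   Context: A Prüfer domain is an integral domain $D$ such that $D_P$ is a valuation domain for every $P\in\operatorname{Spec}(D)$. For an integral domain $D$ with quotient field $K$, an element $z\in K$ is almost integral over $D$ if there is a nonzero $c\in D$ such that $cz^n\in D$ for every positive integer $n$; the complete integral closure $D^\ast$ of $D$ is the ring of all elements of $K$ that are almost integral over $D$. $\operatorname{Spec}^\ast(D)$ denotes the set of all $P\in\operatorname{Spec}(D)$ such that $PD^\ast\neq D^\ast$. Spectra are endowed with the Zariski topology. *)

theory Defs
  imports "HOL-Algebra.Algebra" "HOL-Analysis.Abstract_Topology"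
begin

section \<open>The quotient field of an integral domain\<close>

text \<open>The fraction \<open>a/b\<close> is the class of the pair \<open>(a, b)\<close> under \<open>a/b = c/d \<longleftrightarrow> ad = cb\<close>.\<close>

definition fraction :: "('a, 'm) ring_scheme \<Rightarrow> 'a \<Rightarrow> 'a \<Rightarrow> ('a \<times> 'a) set" where
  "fraction R a b = {(c, d). c \<in> carrier R \<and> d \<in> carrier R - {\<zero>\<^bsub>R\<^esub>} \<and> a \<otimes>\<^bsub>R\<^esub> d = c \<otimes>\<^bsub>R\<^esub> b}"

text \<open>The unions below combine all representatives; they all yield the same class, see
  \<open>quot_field_mult\<close> and \<open>quot_field_add\<close>.\<close>

definition quot_field :: "('a, 'm) ring_scheme \<Rightarrow> ('a \<times> 'a) set ring" where
  "quot_field R =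
    \<lparr>carrier = {fraction R a b | a b. a \<in> carrier R \<and> b \<in> carrier R - {\<zero>\<^bsub>R\<^esub>}},
     monoid.mult = (\<lambda>A B. \<Union>(a, b)\<in>A. \<Union>(c, d)\<in>B. fraction R (a \<otimes>\<^bsub>R\<^esub> c) (b \<otimes>\<^bsub>R\<^esub> d)),
     one = fraction R \<one>\<^bsub>R\<^esub> \<one>\<^bsub>R\<^esub>,
     ring.zero = fraction R \<zero>\<^bsub>R\<^esub> \<one>\<^bsub>R\<^esub>,
     ring.add = (\<lambda>A B. \<Union>(a, b)\<in>A. \<Union>(c, d)\<in>B.
              fraction R (a \<otimes>\<^bsub>R\<^esub> d \<oplus>\<^bsub>R\<^esub> c \<otimes>\<^bsub>R\<^esub> b) (b \<otimes>\<^bsub>R\<^esub> d))\<rparr>"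

definition quot_embed :: "('a, 'm) ring_scheme \<Rightarrow> 'a \<Rightarrow> ('a \<times> 'a) set" where
  "quot_embed R a = fraction R a \<one>\<^bsub>R\<^esub>"

context "domain"
begin

lemma fraction_eq_iff:
  assumes "a \<in> carrier R" "b \<in> carrier R - {\<zero>}" "c \<in> carrier R" "d \<in> carrier R - {\<zero>}"
  shows "fraction R a b = fraction R c d \<longleftrightarrow> a \<otimes> d = c \<otimes> b"
proof
  assume "fraction R a b = fraction R c d"
  moreover have "(c, d) \<in> fraction R c d" using assms by (simp add: fraction_def)
  ultimately have "(c, d) \<in> fraction R a b" by simp
  then show "a \<otimes> d = c \<otimes> b" by (simp add: fraction_def)
next
  assume eq: "a \<otimes> d = c \<otimes> b"
  have key: "a \<otimes> f = e \<otimes> b \<longleftrightarrow> c \<otimes> f = e \<otimes> d"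
    if ef: "e \<in> carrier R" "f \<in> carrier R - {\<zero>}" for e f
  proof -
    have "a \<otimes> f = e \<otimes> b \<longleftrightarrow> d \<otimes> (a \<otimes> f) = d \<otimes> (e \<otimes> b)"
      using assms ef m_lcancel[of d "a \<otimes> f" "e \<otimes> b"] by auto
    also have "d \<otimes> (a \<otimes> f) = b \<otimes> (c \<otimes> f)"
    proof -
      have "d \<otimes> (a \<otimes> f) = (a \<otimes> d) \<otimes> f" using assms ef by (simp add: m_ac)
      also have "\<dots> = b \<otimes> (c \<otimes> f)" unfolding eq using assms ef by (simp add: m_ac)
      finally show ?thesis .
    qed
    also have "d \<otimes> (e \<otimes> b) = b \<otimes> (e \<otimes> d)" using assms ef by (simp add: m_ac)
    also have "b \<otimes> (c \<otimes> f) = b \<otimes> (e \<otimes> d) \<longleftrightarrow> c \<otimes> f = e \<otimes> d"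
      using assms ef m_lcancel[of b "c \<otimes> f" "e \<otimes> d"] by auto
    finally show ?thesis .
  qed
  show "fraction R a b = fraction R c d"
    unfolding fraction_def using key by blast
qed

lemma fraction_self:
  assumes "a \<in> carrier R" "b \<in> carrier R - {\<zero>}"
  shows "(a, b) \<in> fraction R a b"
  using assms by (simp add: fraction_def)

lemma fraction_memD:
  assumes "(c, d) \<in> fraction R a b"
  shows "c \<in> carrier R" "d \<in> carrier R - {\<zero>}" "a \<otimes> d = c \<otimes> b"
  using assms by (auto simp: fraction_def)

lemma nonzero_mult:
  assumes "a \<in> carrier R - {\<zero>}" "b \<in> carrier R - {\<zero>}"
  shows "a \<otimes> b \<in> carrier R - {\<zero>}"
  using assms integral_iff by auto

lemma fraction_UN:
  assumes "a \<in> carrier R" "b \<in> carrier R - {\<zero>}" "c \<in> carrier R" "d \<in> carrier R - {\<zero>}"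
    and "\<And>a' b' c' d'. (a', b') \<in> fraction R a b \<Longrightarrow> (c', d') \<in> fraction R c d \<Longrightarrow> f a' b' c' d' = Z"
  shows "(\<Union>(x, y)\<in>fraction R a b. \<Union>(z, w)\<in>fraction R c d. f x y z w) = Z"
proof -
  have "(\<Union>(x, y)\<in>fraction R a b. \<Union>(z, w)\<in>fraction R c d. f x y z w)
      = (\<Union>(x, y)\<in>fraction R a b. \<Union>(z, w)\<in>fraction R c d. Z)"
    by (intro SUP_cong refl) (auto simp: assms(5) split: prod.splits)
  then show ?thesis using fraction_self[OF assms(1,2)] fraction_self[OF assms(3,4)] by auto
qed

lemma quot_field_mult:
  assumes "a \<in> carrier R" "b \<in> carrier R - {\<zero>}" "c \<in> carrier R" "d \<in> carrier R - {\<zero>}"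
  shows "fraction R a b \<otimes>\<^bsub>quot_field R\<^esub> fraction R c d = fraction R (a \<otimes> c) (b \<otimes> d)"
  unfolding quot_field_def monoid.simps
proof (rule fraction_UN[OF assms])
  fix a' b' c' d' assume "(a', b') \<in> fraction R a b" "(c', d') \<in> fraction R c d"
  note h = fraction_memD[OF this(1)] fraction_memD[OF this(2)]
  have "(a' \<otimes> c') \<otimes> (b \<otimes> d) = (a' \<otimes> b) \<otimes> (c' \<otimes> d)" using assms h(1,2,4,5) by (simp add: m_ac)
  also have "\<dots> = (a \<otimes> b') \<otimes> (c \<otimes> d')" using h by simp
  also have "\<dots> = (a \<otimes> c) \<otimes> (b' \<otimes> d')" using assms h(1,2,4,5) by (simp add: m_ac)
  finally show "fraction R (a' \<otimes> c') (b' \<otimes> d') = fraction R (a \<otimes> c) (b \<otimes> d)"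
    using assms h nonzero_mult by (subst fraction_eq_iff) auto
qed

lemma quot_field_add:
  assumes "a \<in> carrier R" "b \<in> carrier R - {\<zero>}" "c \<in> carrier R" "d \<in> carrier R - {\<zero>}"
  shows "fraction R a b \<oplus>\<^bsub>quot_field R\<^esub> fraction R c d = fraction R (a \<otimes> d \<oplus> c \<otimes> b) (b \<otimes> d)"
  unfolding quot_field_def ring.simps
proof (rule fraction_UN[OF assms])
  fix a' b' c' d' assume "(a', b') \<in> fraction R a b" "(c', d') \<in> fraction R c d"
  note h = fraction_memD[OF this(1)] fraction_memD[OF this(2)]
  have "(a' \<otimes> d' \<oplus> c' \<otimes> b') \<otimes> (b \<otimes> d) = (a' \<otimes> b) \<otimes> (d \<otimes> d') \<oplus> (c' \<otimes> d) \<otimes> (b \<otimes> b')"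
    using assms h(1,2,4,5) by (simp add: m_ac l_distr r_distr)
  also have "\<dots> = (a \<otimes> b') \<otimes> (d \<otimes> d') \<oplus> (c \<otimes> d') \<otimes> (b \<otimes> b')" using h by simp
  also have "\<dots> = (a \<otimes> d \<oplus> c \<otimes> b) \<otimes> (b' \<otimes> d')" using assms h(1,2,4,5) by (simp add: m_ac l_distr r_distr)
  finally show "fraction R (a' \<otimes> d' \<oplus> c' \<otimes> b') (b' \<otimes> d') = fraction R (a \<otimes> d \<oplus> c \<otimes> b) (b \<otimes> d)"
    using assms h nonzero_mult by (subst fraction_eq_iff) auto
qed

lemma quot_field_simps:
  "carrier (quot_field R) = {fraction R a b | a b. a \<in> carrier R \<and> b \<in> carrier R - {\<zero>}}"
  "\<one>\<^bsub>quot_field R\<^esub> = fraction R \<one> \<one>" "\<zero>\<^bsub>quot_field R\<^esub> = fraction R \<zero> \<one>"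
  by (simp_all add: quot_field_def)

lemma quot_field_cases:
  assumes "x \<in> carrier (quot_field R)"
  obtains a b where "a \<in> carrier R" "b \<in> carrier R" "b \<noteq> \<zero>" "x = fraction R a b"
  using assms by (auto simp: quot_field_simps)

lemma fraction_closed:
  "a \<in> carrier R \<Longrightarrow> b \<in> carrier R \<Longrightarrow> b \<noteq> \<zero> \<Longrightarrow> fraction R a b \<in> carrier (quot_field R)"
  by (auto simp: quot_field_simps)

lemma fraction_eq_zero_iff:
  assumes "a \<in> carrier R" "b \<in> carrier R" "b \<noteq> \<zero>"
  shows "fraction R a b = \<zero>\<^bsub>quot_field R\<^esub> \<longleftrightarrow> a = \<zero>"
  using assms by (simp add: quot_field_simps fraction_eq_iff)

lemma quot_field_cring: "cring (quot_field R)"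
proof (intro cringI abelian_groupI comm_monoidI)
  let ?K = "quot_field R"
  note s = quot_field_add quot_field_mult fraction_eq_iff integral_iff m_ac l_distr r_distr a_ac
  show "\<zero>\<^bsub>?K\<^esub> \<in> carrier ?K" "\<one>\<^bsub>?K\<^esub> \<in> carrier ?K"
    by (simp_all add: quot_field_simps(2,3) fraction_closed)
  fix x assume x: "x \<in> carrier ?K"
  then obtain a b where ab: "a \<in> carrier R" "b \<in> carrier R" "b \<noteq> \<zero>" "x = fraction R a b"
    by (rule quot_field_cases)
  show "\<zero>\<^bsub>?K\<^esub> \<oplus>\<^bsub>?K\<^esub> x = x" using ab by (simp add: quot_field_simps s)
  show "\<one>\<^bsub>?K\<^esub> \<otimes>\<^bsub>?K\<^esub> x = x" using ab by (simp add: quot_field_simps s)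
  show "\<exists>y\<in>carrier ?K. y \<oplus>\<^bsub>?K\<^esub> x = \<zero>\<^bsub>?K\<^esub>"
  proof
    have "\<ominus> a \<otimes> b \<oplus> a \<otimes> b = \<zero>" using ab by (simp add: l_minus l_neg)
    then show "fraction R (\<ominus> a) b \<oplus>\<^bsub>?K\<^esub> x = \<zero>\<^bsub>?K\<^esub>"
      using ab by (simp add: quot_field_add fraction_eq_zero_iff integral_iff)
    show "fraction R (\<ominus> a) b \<in> carrier ?K" using ab by (simp add: fraction_closed)
  qed
  fix y assume "y \<in> carrier ?K"
  then obtain c d where cd: "c \<in> carrier R" "d \<in> carrier R" "d \<noteq> \<zero>" "y = fraction R c d"
    by (rule quot_field_cases)
  show "x \<oplus>\<^bsub>?K\<^esub> y \<in> carrier ?K" "x \<otimes>\<^bsub>?K\<^esub> y \<in> carrier ?K"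
    using ab cd by (auto simp: quot_field_add quot_field_mult integral_iff intro!: fraction_closed)
  show "x \<oplus>\<^bsub>?K\<^esub> y = y \<oplus>\<^bsub>?K\<^esub> x" "x \<otimes>\<^bsub>?K\<^esub> y = y \<otimes>\<^bsub>?K\<^esub> x"
    using ab cd by (simp_all add: quot_field_add quot_field_mult m_comm a_comm)
  fix z assume "z \<in> carrier ?K"
  then obtain e f where ef: "e \<in> carrier R" "f \<in> carrier R" "f \<noteq> \<zero>" "z = fraction R e f"
    by (rule quot_field_cases)
  show "x \<oplus>\<^bsub>?K\<^esub> y \<oplus>\<^bsub>?K\<^esub> z = x \<oplus>\<^bsub>?K\<^esub> (y \<oplus>\<^bsub>?K\<^esub> z)" using ab cd ef by (simp add: s)
  show "x \<otimes>\<^bsub>?K\<^esub> y \<otimes>\<^bsub>?K\<^esub> z = x \<otimes>\<^bsub>?K\<^esub> (y \<otimes>\<^bsub>?K\<^esub> z)" using ab cd ef by (simp add: s)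
  show "(x \<oplus>\<^bsub>?K\<^esub> y) \<otimes>\<^bsub>?K\<^esub> z = x \<otimes>\<^bsub>?K\<^esub> z \<oplus>\<^bsub>?K\<^esub> y \<otimes>\<^bsub>?K\<^esub> z" using ab cd ef by (simp add: s)
qed

lemma quot_field_field: "field (quot_field R)"
proof -
  interpret K: cring "quot_field R" by (rule quot_field_cring)
  show ?thesis
  proof (rule K.cring_fieldI2)
    show "\<zero>\<^bsub>quot_field R\<^esub> \<noteq> \<one>\<^bsub>quot_field R\<^esub>"
      using fraction_eq_zero_iff[of \<one> \<one>] by (auto simp: quot_field_simps(2))
    fix x assume "x \<in> carrier (quot_field R)" and nz: "x \<noteq> \<zero>\<^bsub>quot_field R\<^esub>"
    then obtain a b where ab: "a \<in> carrier R" "b \<in> carrier R" "b \<noteq> \<zero>" "x = fraction R a b"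
      by (elim quot_field_cases)
    then have "a \<noteq> \<zero>" using nz fraction_eq_zero_iff by auto
    then show "\<exists>y\<in>carrier (quot_field R). x \<otimes>\<^bsub>quot_field R\<^esub> y = \<one>\<^bsub>quot_field R\<^esub>"
      using ab by (intro bexI[of _ "fraction R b a"])
        (auto simp: quot_field_simps(2) quot_field_mult fraction_eq_iff integral_iff m_comm
          intro: fraction_closed)
  qed
qed

lemma quot_embed_hom: "quot_embed R \<in> ring_hom R (quot_field R)"
  by (rule ring_hom_memI)
    (auto simp: quot_embed_def fraction_closed quot_field_mult quot_field_add quot_field_simps(2))

lemma quot_embed_inj: "inj_on (quot_embed R) (carrier R)"
  by (rule inj_onI) (simp add: quot_embed_def fraction_eq_iff)

end


section \<open>The prime spectrum\<close>

definition Spec :: "('a, 'm) ring_scheme \<Rightarrow> 'a set set" where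
  "Spec R = {P. primeideal P R}"

definition zariski_closed :: "('a, 'm) ring_scheme \<Rightarrow> 'a set \<Rightarrow> 'a set set" where
  "zariski_closed R S = {P \<in> Spec R. S \<subseteq> P}"

definition zariski_topology :: "('a, 'm) ring_scheme \<Rightarrow> 'a set topology" where
  "zariski_topology R =
    topology (\<lambda>U. \<exists>S \<subseteq> carrier R. U = Spec R - zariski_closed R S)"

lemma Spec_mult_mem_iff:
  assumes "P \<in> Spec R" "a \<in> carrier R" "b \<in> carrier R"
  shows "a \<otimes>\<^bsub>R\<^esub> b \<in> P \<longleftrightarrow> a \<in> P \<or> b \<in> P"
proof -
  interpret primeideal P R using assms(1) by (simp add: Spec_def)
  show ?thesis using assms(2,3) I_prime I_l_closed I_r_closed by blast
qed

context cring
begin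

lemma istopology_zariski:
  "istopology (\<lambda>U. \<exists>S \<subseteq> carrier R. U = Spec R - zariski_closed R S)"
  unfolding istopology_def
proof (intro conjI allI impI)
  fix U V
  assume "\<exists>S \<subseteq> carrier R. U = Spec R - zariski_closed R S"
    and "\<exists>S \<subseteq> carrier R. V = Spec R - zariski_closed R S"
  then obtain S T where ST: "S \<subseteq> carrier R" "U = Spec R - zariski_closed R S"
      "T \<subseteq> carrier R" "V = Spec R - zariski_closed R T" by blast
  let ?M = "{s \<otimes> t | s t. s \<in> S \<and> t \<in> T}"
  have "P \<in> zariski_closed R ?M \<longleftrightarrow> P \<in> zariski_closed R S \<or> P \<in> zariski_closed R T"
    if P: "P \<in> Spec R" for P
  proof -
    have "?M \<subseteq> P \<longleftrightarrow> (\<forall>s\<in>S. \<forall>t\<in>T. s \<otimes> t \<in> P)" by blast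
    also have "\<dots> \<longleftrightarrow> (\<forall>s\<in>S. \<forall>t\<in>T. s \<in> P \<or> t \<in> P)"
      using Spec_mult_mem_iff[OF P] ST(1,3) by (meson subsetD)
    also have "\<dots> \<longleftrightarrow> S \<subseteq> P \<or> T \<subseteq> P" by blast
    finally show ?thesis using P by (simp add: zariski_closed_def)
  qed
  then have "U \<inter> V = Spec R - zariski_closed R ?M" unfolding ST by blast
  moreover have "?M \<subseteq> carrier R" using ST by auto
  ultimately show "\<exists>S \<subseteq> carrier R. U \<inter> V = Spec R - zariski_closed R S" by blast
next
  fix \<U>
  assume "\<forall>U\<in>\<U>. \<exists>S \<subseteq> carrier R. U = Spec R - zariski_closed R S"
  then obtain f where f: "\<And>U. U \<in> \<U> \<Longrightarrow> f U \<subseteq> carrier R \<and> U = Spec R - zariski_closed R (f U)"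
    by metis
  have "\<Union>\<U> = Spec R - zariski_closed R (\<Union>(f ` \<U>))"
  proof (rule equalityI; rule subsetI)
    fix P assume "P \<in> \<Union>\<U>"
    then obtain U where "U \<in> \<U>" "P \<in> U" by blast
    then show "P \<in> Spec R - zariski_closed R (\<Union>(f ` \<U>))"
      using f[of U] by (auto simp: zariski_closed_def)
  next
    fix P assume P: "P \<in> Spec R - zariski_closed R (\<Union>(f ` \<U>))"
    then obtain U where U: "U \<in> \<U>" "\<not> f U \<subseteq> P" by (auto simp: zariski_closed_def)
    then have "P \<in> Spec R - zariski_closed R (f U)" using P by (auto simp: zariski_closed_def)
    then show "P \<in> \<Union>\<U>" using f[OF U(1)] U(1) by blast
  qed
  moreover have "\<Union>(f ` \<U>) \<subseteq> carrier R" using f by blast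
  ultimately show "\<exists>S \<subseteq> carrier R. \<Union>\<U> = Spec R - zariski_closed R S" by blast
qed

lemma openin_zariski:
  "openin (zariski_topology R) U \<longleftrightarrow> (\<exists>S \<subseteq> carrier R. U = Spec R - zariski_closed R S)"
  unfolding zariski_topology_def topology_inverse'[OF istopology_zariski] ..

lemma topspace_zariski: "topspace (zariski_topology R) = Spec R"
proof
  show "topspace (zariski_topology R) \<subseteq> Spec R"
    using openin_topspace[of "zariski_topology R"] unfolding openin_zariski by blast
  have "P \<notin> zariski_closed R (carrier R)" for P
  proof
    assume "P \<in> zariski_closed R (carrier R)"
    then have "primeideal P R" and "carrier R \<subseteq> P" by (auto simp: zariski_closed_def Spec_def)
    then interpret primeideal P R by simp
    show False using I_notcarr \<open>carrier R \<subseteq> P\<close> Icarr by blast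
  qed
  then have "openin (zariski_topology R) (Spec R)"
    unfolding openin_zariski by blast
  then show "Spec R \<subseteq> topspace (zariski_topology R)" by (rule openin_subset)
qed

lemma closedin_zariski:
  "closedin (zariski_topology R) C \<longleftrightarrow> (\<exists>S \<subseteq> carrier R. C = zariski_closed R S)"
proof -
  have "zariski_closed R S \<subseteq> Spec R" for S by (auto simp: zariski_closed_def)
  then show ?thesis
    unfolding closedin_def topspace_zariski openin_zariski by (metis double_diff subset_refl)
qed

end


section \<open>Valuation domains and Pruefer domains\<close>

definition valuation_domain :: "('a, 'm) ring_scheme \<Rightarrow> bool" where
  "valuation_domain V \<longleftrightarrow> domain V \<and>
    (\<forall>x \<in> carrier (quot_field V) - {\<zero>\<^bsub>quot_field V\<^esub>}.
       x \<in> quot_embed V ` carrier V \<or> inv\<^bsub>quot_field V\<^esub> x \<in> quot_embed V ` carrier V)"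

text \<open>The localization at \<open>P\<close> is taken as a subring of the quotient field.\<close>

definition localization_at :: "('a, 'm) ring_scheme \<Rightarrow> 'a set \<Rightarrow> ('a \<times> 'a) set ring" where
  "localization_at D P =
    quot_field D \<lparr>carrier := {fraction D a s | a s. a \<in> carrier D \<and> s \<in> carrier D - P}\<rparr>"

definition prufer_domain :: "('a, 'm) ring_scheme \<Rightarrow> bool" where
  "prufer_domain D \<longleftrightarrow> domain D \<and> (\<forall>P \<in> Spec D. valuation_domain (localization_at D P))"

lemma (in "domain") localization_at_subring:
  assumes "P \<in> Spec R"
  shows "subring (carrier (localization_at R P)) (quot_field R)"
proof -
  interpret K: field "quot_field R" by (rule quot_field_field)
  interpret P: primeideal P R using assms by (simp add: Spec_def)
  let ?L = "{fraction R a s | a s. a \<in> carrier R \<and> s \<in> carrier R - P}"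
  have zero: "\<zero> \<in> P" by (rule P.zero_closed)
  have one: "\<one> \<notin> P" using P.I_notcarr P.one_imp_carrier by blast
  have "subring ?L (quot_field R)"
  proof (rule K.subringI)
    show "?L \<subseteq> carrier (quot_field R)" using zero fraction_closed by blast
    show "\<one>\<^bsub>quot_field R\<^esub> \<in> ?L" using one unfolding quot_field_simps(2) by blast
    fix x assume "x \<in> ?L"
    then obtain a s where x: "x = fraction R a s" "a \<in> carrier R" "s \<in> carrier R" "s \<notin> P" by blast
    have s0: "s \<noteq> \<zero>" using x zero by blast
    have xK: "x \<in> carrier (quot_field R)" using x s0 fraction_closed by blast
    have "fraction R (\<ominus> a) s \<oplus>\<^bsub>quot_field R\<^esub> x = \<zero>\<^bsub>quot_field R\<^esub>"
    proof -
      have "\<ominus> a \<otimes> s \<oplus> a \<otimes> s = \<zero>" using x by (simp add: l_minus l_neg)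
      then show ?thesis using x s0 by (simp add: quot_field_add fraction_eq_zero_iff integral_iff)
    qed
    then have "\<ominus>\<^bsub>quot_field R\<^esub> x = fraction R (\<ominus> a) s"
      using x s0 xK by (intro K.minus_equality) (auto intro: fraction_closed)
    then show "\<ominus>\<^bsub>quot_field R\<^esub> x \<in> ?L" using x by auto
    fix y assume "y \<in> ?L"
    then obtain b t where y: "y = fraction R b t" "b \<in> carrier R" "t \<in> carrier R" "t \<notin> P" by blast
    have t0: "t \<noteq> \<zero>" using y zero by blast
    have st: "s \<otimes> t \<in> carrier R - P" using x y Spec_mult_mem_iff[OF assms] by auto
    show "x \<otimes>\<^bsub>quot_field R\<^esub> y \<in> ?L"
      using x y s0 t0 st by (auto simp: quot_field_mult)
    show "x \<oplus>\<^bsub>quot_field R\<^esub> y \<in> ?L"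
    proof -
      have "x \<oplus>\<^bsub>quot_field R\<^esub> y = fraction R (a \<otimes> t \<oplus> b \<otimes> s) (s \<otimes> t)"
        using x y s0 t0 by (simp add: quot_field_add)
      moreover have "a \<otimes> t \<oplus> b \<otimes> s \<in> carrier R" using x y by simp
      ultimately show ?thesis using st by blast
    qed
  qed
  then show ?thesis by (simp add: localization_at_def)
qed


section \<open>Complete integral closure\<close>

definition almost_integral :: "('a, 'm) ring_scheme \<Rightarrow> ('a \<times> 'a) set \<Rightarrow> bool" where
  "almost_integral D z \<longleftrightarrow> z \<in> carrier (quot_field D) \<and>
    (\<exists>c \<in> carrier D - {\<zero>\<^bsub>D\<^esub>}. \<forall>n::nat. n > 0 \<longrightarrow>
       quot_embed D c \<otimes>\<^bsub>quot_field D\<^esub> z [^]\<^bsub>quot_field D\<^esub> n \<in> quot_embed D ` carrier D)"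

definition complete_integral_closure :: "('a, 'm) ring_scheme \<Rightarrow> ('a \<times> 'a) set ring" where
  "complete_integral_closure D = quot_field D \<lparr>carrier := {z. almost_integral D z}\<rparr>"

definition Spec_star :: "('a, 'm) ring_scheme \<Rightarrow> 'a set set" where
  "Spec_star D = {P \<in> Spec D.
     Idl\<^bsub>complete_integral_closure D\<^esub> (quot_embed D ` P) \<noteq> carrier (complete_integral_closure D)}"

end

theory Submission
  imports Defs
begin

text \<open>For a Pruefer domain \<open>D\<close>, a prime \<open>P\<close> lies in \<open>Spec\<^sup>* D\<close> iff \<open>D\<^sup>* \<subseteq> D\<^sub>P\<close>: if
  \<open>z \<in> D\<^sup>*\<close> is not in \<open>D\<^sub>P\<close>, then \<open>P\<close> contains the denominator ideal \<open>I = (D : z)\<close>, and \<open>I\<close> is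
  generated by some \<open>i, j\<close> with \<open>i + z j = 1\<close>. In a Pruefer domain \<open>c z\<^sup>n \<in> D\<close> for all \<open>n\<close> means
  \<open>c \<in> I\<^sup>n\<close> for all \<open>n\<close>. Locally at a prime \<open>Q \<supseteq> I\<close> the ideal \<open>I\<close> is principal and the intersection of
  its powers is the largest prime below \<open>Q\<close> not containing \<open>I\<close>. So \<open>P\<close> is outside \<open>Spec\<^sup>* D\<close> iff it
  contains a finitely generated \<open>I\<close> for which some \<open>c \<noteq> 0\<close> has the property that every prime
  above \<open>I\<close> contains a prime through \<open>c\<close> that is not above \<open>I\<close>. Since finitely generated ideals
  cut out the closed sets with quasi-compact complement, this is a topological condition.\<close>

section \<open>Ideals and primes of commutative rings\<close>

lemma (in cring) ideal_cringI:
  assumes "I \<subseteq> carrier R" "\<zero> \<in> I"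
    and "\<And>x y. x \<in> I \<Longrightarrow> y \<in> I \<Longrightarrow> x \<oplus> y \<in> I"
    and "\<And>a x. a \<in> carrier R \<Longrightarrow> x \<in> I \<Longrightarrow> a \<otimes> x \<in> I"
  shows "ideal I R"
proof (rule idealI[OF ring_axioms])
  show "subgroup I (add_monoid R)"
  proof (rule add.subgroupI)
    fix x assume "x \<in> I"
    then show "\<ominus> x \<in> I"
      using assms(4)[of "\<ominus> \<one>" x] assms(1) by (auto simp: l_minus)
  qed (use assms in auto)
  fix a x assume "a \<in> I" "x \<in> carrier R"
  then show "x \<otimes> a \<in> I" "a \<otimes> x \<in> I"
    using assms(4)[of x a] assms(1) by (auto simp: m_comm subset_iff)
qed

text \<open>Zorn gives an ideal \<open>P\<close> maximal among those containing \<open>I\<close> and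
  missing \<open>S\<close>. It is prime: if \<open>a, b\<close> lie outside \<open>P\<close>, then
  \<open>P + (a)\<close> and \<open>P + (b)\<close> both meet \<open>S\<close>, and the product of
  two such elements of \<open>S\<close> lies in \<open>P + (a b)\<close>.\<close>

lemma (in cring) prime_separation:
  assumes I: "ideal I R" and S: "S \<subseteq> carrier R" "\<one> \<in> S" "I \<inter> S = {}"
    and mult: "\<And>x y. x \<in> S \<Longrightarrow> y \<in> S \<Longrightarrow> x \<otimes> y \<in> S"
  obtains P where "P \<in> Spec R" "I \<subseteq> P" "P \<inter> S = {}"
proof -
  let ?A = "{J. ideal J R \<and> I \<subseteq> J \<and> J \<inter> S = {}}"
  have "\<exists>M\<in>?A. \<forall>N\<in>?A. M \<subseteq> N \<longrightarrow> N = M"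
  proof (rule subset_Zorn_nonempty)
    show "?A \<noteq> {}" using I S by blast
    fix \<C> assume ne: "\<C> \<noteq> {}" and ch: "subset.chain ?A \<C>"
    then have "subset.chain {J. ideal J R} \<C>" by (auto simp: subset_chain_def)
    from chain_Union_is_ideal[OF this] ne have "ideal (\<Union>\<C>) R" by simp
    then show "\<Union>\<C> \<in> ?A" using ne ch by (auto simp: subset_chain_def)
  qed
  then obtain P where P_mem: "P \<in> ?A" and P_max: "\<forall>N\<in>?A. P \<subseteq> N \<longrightarrow> N = P" ..
  from P_mem have P: "ideal P R" "I \<subseteq> P" "P \<inter> S = {}" by simp_all
  have max: "J = P" if "ideal J R" "P \<subseteq> J" "J \<inter> S = {}" for J
    using P_max P(2) that by (simp add: subset_trans[OF P(2)])
  interpret P: ideal P R by (rule P(1))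
  have meet: "\<exists>p\<in>P. \<exists>r\<in>carrier R. p \<oplus> r \<otimes> a \<in> S" if a: "a \<in> carrier R" "a \<notin> P" for a
  proof -
    let ?J = "P <+>\<^bsub>R\<^esub> PIdl a"
    have J: "ideal ?J R" by (rule add_ideals[OF P(1) cgenideal_ideal[OF a(1)]])
    have mem: "p \<oplus> r \<otimes> a \<in> ?J" if "p \<in> P" "r \<in> carrier R" for p r
      using that by (auto simp: set_add_def' cgenideal_def)
    have "P \<subseteq> ?J" using mem[of _ \<zero>] a(1) P.Icarr by (auto simp: subset_iff)
    moreover have "a \<in> ?J" using mem[of \<zero> \<one>] a(1) by auto
    ultimately obtain x where "x \<in> ?J" "x \<in> S" using max[OF J] a(2) by blast
    then show ?thesis by (auto simp: set_add_def' cgenideal_def)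
  qed
  have "primeideal P R"
  proof (rule primeidealI[OF P(1) is_cring])
    show "carrier R \<noteq> P" using S P(3) by blast
    fix a b assume ab: "a \<in> carrier R" "b \<in> carrier R" "a \<otimes> b \<in> P"
    show "a \<in> P \<or> b \<in> P"
    proof (rule ccontr)
      assume "\<not> (a \<in> P \<or> b \<in> P)"
      then obtain p r q t where *: "p \<in> P" "r \<in> carrier R" "p \<oplus> r \<otimes> a \<in> S"
        "q \<in> P" "t \<in> carrier R" "q \<oplus> t \<otimes> b \<in> S"
        using meet[of a] meet[of b] ab by blast
      have "(p \<oplus> r \<otimes> a) \<otimes> (q \<oplus> t \<otimes> b)
          = p \<otimes> (q \<oplus> t \<otimes> b) \<oplus> ((r \<otimes> a) \<otimes> q \<oplus> (r \<otimes> t) \<otimes> (a \<otimes> b))"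
        using * ab P.Icarr by (simp add: l_distr r_distr m_ac a_ac)
      also have "\<dots> \<in> P" using * ab P.Icarr by (simp add: P.I_l_closed P.I_r_closed)
      finally show False using mult[OF *(3) *(6)] P(3) by blast
    qed
  qed
  then show thesis using that[of P] P by (simp add: Spec_def)
qed

lemma (in cring) ideal_subset_prime:
  assumes I: "ideal I R" and "\<one> \<notin> I"
  obtains P where "P \<in> Spec R" "I \<subseteq> P"
proof -
  have "I \<inter> {\<one>} = {}" using assms(2) by blast
  then obtain P where "P \<in> Spec R" "I \<subseteq> P"
    by (rule prime_separation[OF I, rotated 2]) auto
  then show thesis by (rule that)
qed

lemma Spec_facts:
  assumes "P \<in> Spec R"
  shows Spec_subset: "P \<subseteq> carrier R" and Spec_zero: "\<zero>\<^bsub>R\<^esub> \<in> P" and Spec_one: "\<one>\<^bsub>R\<^esub> \<notin> P"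
proof -
  interpret primeideal P R using assms by (simp add: Spec_def)
  show "P \<subseteq> carrier R" "\<zero>\<^bsub>R\<^esub> \<in> P" using zero_closed by (auto intro: Icarr)
  show "\<one>\<^bsub>R\<^esub> \<notin> P" using I_notcarr one_imp_carrier by blast
qed

lemma Spec_add:
  assumes "P \<in> Spec R" "a \<in> P" "b \<in> P"
  shows "a \<oplus>\<^bsub>R\<^esub> b \<in> P"
proof -
  interpret primeideal P R using assms by (simp add: Spec_def)
  show ?thesis using assms by simp
qed

lemma (in cring) Spec_pow_mem:
  assumes "P \<in> Spec R" "a \<in> carrier R" "a [^] (n::nat) \<in> P"
  shows "a \<in> P"
proof -
  interpret primeideal P R using assms by (simp add: Spec_def)
  show ?thesis
    using assms(3)
  proof (induction n)
    case 0
    then show ?case using Spec_one[OF assms(1)] by simp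
  next
    case (Suc n)
    then show ?case using Spec_mult_mem_iff[OF assms(1)] assms(2) by auto
  qed
qed

lemma (in cring) Spec_divides:
  assumes "P \<in> Spec R" "a divides b" "a \<in> P"
  shows "b \<in> P"
  using assms Spec_mult_mem_iff[OF assms(1)] Spec_subset[OF assms(1)] by (auto elim!: dividesE)

text \<open>The \<open>u\<close> for which \<open>b\<close> divides \<open>u a\<close> form an
  ideal. By \<open>loc\<close> no prime contains it, so it contains \<open>\<one>\<close>.\<close>

lemma (in cring) divides_if_locally_divides:
  assumes ab: "a \<in> carrier R" "b \<in> carrier R"
    and loc: "\<And>P. P \<in> Spec R \<Longrightarrow> \<exists>u\<in>carrier R - P. b divides u \<otimes> a"
  shows "b divides a"
proof (rule ccontr)
  assume n: "\<not> b divides a"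
  let ?I = "{u \<in> carrier R. b divides u \<otimes> a}"
  have "ideal ?I R"
  proof (rule ideal_cringI)
    show "\<zero> \<in> ?I" using ab by (auto intro!: dividesI[of \<zero>])
    fix x y assume xy: "x \<in> ?I" "y \<in> ?I"
    then obtain v w where "v \<in> carrier R" "x \<otimes> a = b \<otimes> v" "w \<in> carrier R" "y \<otimes> a = b \<otimes> w"
      by (auto elim!: dividesE)
    then show "x \<oplus> y \<in> ?I"
      using xy ab by (auto simp: l_distr r_distr[symmetric] intro!: dividesI[of "v \<oplus> w"])
  next
    fix x y assume xy: "x \<in> carrier R" "y \<in> ?I"
    then have "(x \<otimes> y) \<otimes> a = x \<otimes> (y \<otimes> a)" using ab by (simp add: m_assoc)
    moreover obtain v where "v \<in> carrier R" "y \<otimes> a = b \<otimes> v" using xy by (auto elim!: dividesE)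
    moreover from this have "x \<otimes> (b \<otimes> v) = b \<otimes> (x \<otimes> v)" using xy ab by (simp add: m_lcomm)
    ultimately show "x \<otimes> y \<in> ?I" using xy by (auto intro!: dividesI[of "x \<otimes> v"])
  qed auto
  moreover have "\<one> \<notin> ?I" using n ab by simp
  ultimately obtain P where "P \<in> Spec R" "?I \<subseteq> P" by (rule ideal_subset_prime)
  then show False using loc by blast
qed

section \<open>Divisibility in localizations\<close>

context "domain"
begin

text \<open>The right-hand side says that the denominator ideal of \<open>a/b\<close> is not inside
  \<open>P\<close>. It moves questions about the localization to divisibility in
  \<open>R\<close>.\<close>

lemma fraction_mem_localization_iff:
  assumes P: "P \<in> Spec R" and ab: "a \<in> carrier R" "b \<in> carrier R" "b \<noteq> \<zero>"
  shows "fraction R a b \<in> carrier (localization_at R P) \<longleftrightarrow> (\<exists>u\<in>carrier R - P. b divides u \<otimes> a)"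
proof
  assume "fraction R a b \<in> carrier (localization_at R P)"
  then obtain t u where tu: "t \<in> carrier R" "u \<in> carrier R - P" "fraction R a b = fraction R t u"
    by (auto simp: localization_at_def)
  then have "u \<in> carrier R - {\<zero>}" using Spec_zero[OF P] by auto
  then have "a \<otimes> u = t \<otimes> b" using tu ab fraction_eq_iff by auto
  then have "u \<otimes> a = b \<otimes> t" using tu ab by (simp add: m_comm)
  then show "\<exists>u\<in>carrier R - P. b divides u \<otimes> a" using tu by blast
next
  assume "\<exists>u\<in>carrier R - P. b divides u \<otimes> a"
  then obtain u t where tu: "t \<in> carrier R" "u \<in> carrier R - P" "u \<otimes> a = b \<otimes> t"
    by (auto elim!: dividesE)
  then have "u \<in> carrier R - {\<zero>}" using Spec_zero[OF P] by auto
  then have "fraction R a b = fraction R t u" using tu ab by (subst fraction_eq_iff) (auto simp: m_comm)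
  then show "fraction R a b \<in> carrier (localization_at R P)" using tu by (auto simp: localization_at_def)
qed

text \<open>For nonzero \<open>a, b\<close> the fractions \<open>a/b\<close> and \<open>b/a\<close>
  are mutually inverse, so one of them comes from \<open>R\<close>.\<close>

lemma valuation_domain_divides:
  assumes "valuation_domain R" "a \<in> carrier R" "b \<in> carrier R"
  shows "a divides b \<or> b divides a"
proof (cases "a = \<zero> \<or> b = \<zero>")
  case True
  then show ?thesis using assms by (auto intro!: dividesI[of \<zero>])
next
  case False
  interpret K: field "quot_field R" by (rule quot_field_field)
  let ?x = "fraction R a b" and ?y = "fraction R b a"
  have x: "?x \<in> carrier (quot_field R)" "?y \<in> carrier (quot_field R)"
    using False assms by (auto intro!: fraction_closed)
  have "?x \<noteq> \<zero>\<^bsub>quot_field R\<^esub>" using False assms by (simp add: fraction_eq_zero_iff)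
  moreover have "inv\<^bsub>quot_field R\<^esub> ?x = ?y"
    using False assms x
    by (intro K.comm_inv_char)
      (auto simp: quot_field_mult quot_field_simps(2) fraction_eq_iff integral_iff m_comm)
  ultimately have "?x \<in> quot_embed R ` carrier R \<or> ?y \<in> quot_embed R ` carrier R"
    using assms(1) x unfolding valuation_domain_def by (metis DiffI singletonD)
  moreover have "d divides c"
    if "c \<in> carrier R" "d \<in> carrier R - {\<zero>}" "fraction R c d \<in> quot_embed R ` carrier R" for c d
  proof -
    from that obtain x where "x \<in> carrier R" "c = x \<otimes> d"
      by (auto simp: quot_embed_def fraction_eq_iff)
    then show ?thesis using that by (auto simp: m_comm[of x d])
  qed
  ultimately show ?thesis using assms False by blast
qed

text \<open>One of \<open>a/1\<close>, \<open>b/1\<close> is the other times some \<open>t/u\<close>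
  of the localization, and clearing \<open>u\<close> gives a divisibility in \<open>R\<close>. The
  valuation property enters the whole argument only through this lemma.\<close>

lemma prufer_locally_comparable:
  assumes "prufer_domain R" and P: "P \<in> Spec R" and ab: "a \<in> carrier R" "b \<in> carrier R"
  shows "\<exists>u\<in>carrier R - P. a divides u \<otimes> b \<or> b divides u \<otimes> a"
proof -
  let ?V = "localization_at R P"
  let ?e = "\<lambda>a. fraction R a \<one>"
  have V: "valuation_domain ?V" using assms by (simp add: prufer_domain_def)
  then interpret V: "domain" ?V by (simp add: valuation_domain_def)
  have e: "?e c \<in> carrier ?V" if "c \<in> carrier R" for c
    using that Spec_one[OF P] by (auto simp: localization_at_def)
  have *: "\<exists>u\<in>carrier R - P. c divides u \<otimes> d"
    if cd: "c \<in> carrier R" "d \<in> carrier R" and dv: "?e c divides\<^bsub>?V\<^esub> ?e d" for c d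
  proof -
    from dv obtain v where "v \<in> carrier ?V" "?e d = ?e c \<otimes>\<^bsub>?V\<^esub> v" by (rule dividesE)
    then obtain t u where tu: "t \<in> carrier R" "u \<in> carrier R - P"
      and eq: "?e d = ?e c \<otimes>\<^bsub>quot_field R\<^esub> fraction R t u"
      by (auto simp: localization_at_def)
    have u: "u \<in> carrier R - {\<zero>}" using tu Spec_zero[OF P] by auto
    then have "?e d = fraction R (c \<otimes> t) u"
      using eq tu cd by (simp add: quot_field_mult)
    then have "u \<otimes> d = c \<otimes> t" using tu u cd by (simp add: fraction_eq_iff m_comm)
    then show ?thesis using tu by blast
  qed
  \<comment> \<open>Working inside \<open>?V\<close> avoids comparing the quotient field of
    \<open>?V\<close> with that of \<open>R\<close>.\<close>
  have "?e a divides\<^bsub>?V\<^esub> ?e b \<or> ?e b divides\<^bsub>?V\<^esub> ?e a"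
    by (rule V.valuation_domain_divides[OF V e[OF ab(1)] e[OF ab(2)]])
  then show ?thesis using *[OF ab] *[OF ab(2,1)] by blast
qed

section \<open>Almost integral elements and the complete integral closure\<close>

lemma fraction_pow:
  assumes "a \<in> carrier R" "b \<in> carrier R" "b \<noteq> \<zero>"
  shows "b [^] n \<noteq> \<zero> \<and> fraction R a b [^]\<^bsub>quot_field R\<^esub> (n::nat) = fraction R (a [^] n) (b [^] n)"
  using assms by (induction n) (auto simp: quot_field_simps quot_field_mult integral_iff)

text \<open>Brings the definition into the shape of \<open>almost_integral_subring\<close>, which
  speaks only of a subring of a domain. The case \<open>n = 0\<close> may be added because the
  multiplier itself comes from \<open>R\<close>.\<close>

lemma almost_integral_iff:
  "almost_integral R z \<longleftrightarrow> z \<in> carrier (quot_field R) \<and>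
    (\<exists>c \<in> quot_embed R ` carrier R - {\<zero>\<^bsub>quot_field R\<^esub>}. \<forall>n::nat.
       c \<otimes>\<^bsub>quot_field R\<^esub> z [^]\<^bsub>quot_field R\<^esub> n \<in> quot_embed R ` carrier R)"
proof -
  interpret K: field "quot_field R" by (rule quot_field_field)
  let ?E = "quot_embed R ` carrier R"
  let ?z = "\<lambda>c n. quot_embed R c \<otimes>\<^bsub>quot_field R\<^esub> z [^]\<^bsub>quot_field R\<^esub> (n::nat)"
  have "(\<forall>n>0. ?z c n \<in> ?E) \<longleftrightarrow> (\<forall>n. ?z c n \<in> ?E)" if "c \<in> carrier R" for c
  proof -
    have "?z c 0 \<in> ?E" using that ring_hom_closed[OF quot_embed_hom] by simp
    then show ?thesis by (metis gr0I)
  qed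
  moreover have "quot_embed R c = \<zero>\<^bsub>quot_field R\<^esub> \<longleftrightarrow> c = \<zero>" if "c \<in> carrier R" for c
    using that by (simp add: quot_embed_def fraction_eq_zero_iff)
  ultimately have "(\<exists>c\<in>carrier R - {\<zero>}. \<forall>n>0. ?z c n \<in> ?E)
      \<longleftrightarrow> (\<exists>c\<in>carrier R. quot_embed R c \<noteq> \<zero>\<^bsub>quot_field R\<^esub> \<and> (\<forall>n. ?z c n \<in> ?E))"
    by (metis DiffD1 DiffD2 DiffI singleton_iff)
  also have "\<dots> \<longleftrightarrow> (\<exists>c\<in>?E - {\<zero>\<^bsub>quot_field R\<^esub>}. \<forall>n. c \<otimes>\<^bsub>quot_field R\<^esub> z [^]\<^bsub>quot_field R\<^esub> (n::nat) \<in> ?E)"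
    by (auto simp del: K.nat_pow_0 nat_pow_0)
  finally show ?thesis unfolding almost_integral_def by blast
qed

text \<open>Clearing denominators turns almost integrality into divisibility in \<open>R\<close>,
  which can be checked prime by prime.\<close>

lemma almost_integral_fraction_iff:
  assumes ab: "a \<in> carrier R" "b \<in> carrier R" "b \<noteq> \<zero>"
  shows "almost_integral R (fraction R a b) \<longleftrightarrow>
    (\<exists>c\<in>carrier R - {\<zero>}. \<forall>n::nat. b [^] n divides c \<otimes> a [^] n)"
proof -
  have "quot_embed R c \<otimes>\<^bsub>quot_field R\<^esub> fraction R a b [^]\<^bsub>quot_field R\<^esub> n \<in> quot_embed R ` carrier R
      \<longleftrightarrow> b [^] n divides c \<otimes> a [^] n" if "c \<in> carrier R" for c and n :: nat
    using that ab fraction_pow[OF ab]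
    by (auto simp: quot_embed_def quot_field_mult fraction_eq_iff m_comm image_iff factor_def)
  then have "almost_integral R (fraction R a b) \<longleftrightarrow>
    (\<exists>c\<in>carrier R - {\<zero>}. \<forall>n>0. b [^] n divides c \<otimes> a [^] (n::nat))"
    using ab by (auto simp: almost_integral_def fraction_closed)
  moreover have "b [^] (0::nat) divides c \<otimes> a [^] (0::nat)" if "c \<in> carrier R" for c
    using that by (auto intro!: dividesI[of c])
  ultimately show ?thesis by (metis DiffD1 gr0I)
qed

text \<open>If \<open>c\<close> serves for \<open>z\<close> and \<open>d\<close> for
  \<open>w\<close>, then \<open>c d\<close> serves for both the product and the sum. The ambient
  domain is meant to be a quotient field, with \<open>E\<close> the image of the original
  domain.\<close>

lemma almost_integral_subring:
  assumes E: "subring E R"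
  shows "subring {z \<in> carrier R. \<exists>c\<in>E - {\<zero>}. \<forall>n::nat. c \<otimes> z [^] n \<in> E} R" (is "subring ?A R")
proof -
  note E_simps = subringE[OF E]
  have E_carr: "x \<in> carrier R" if "x \<in> E" for x using that E_simps(1) by blast
  \<comment> \<open>Generalizing over \<open>i, j\<close> replaces the binomial theorem by an induction on \<open>n\<close>.\<close>
  have sum: "((c \<otimes> z [^] i) \<otimes> (d \<otimes> w [^] j)) \<otimes> (z \<oplus> w) [^] n \<in> E"
    if "c \<in> E" "d \<in> E" "z \<in> carrier R" "w \<in> carrier R"
      "\<forall>n::nat. c \<otimes> z [^] n \<in> E" "\<forall>n::nat. d \<otimes> w [^] n \<in> E" for c d z w and i j n :: nat
  proof (induction n arbitrary: i j)
    case 0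
    then show ?case using that E_simps E_carr by simp
  next
    case (Suc n)
    have eq: "((c \<otimes> z [^] i) \<otimes> (d \<otimes> w [^] j)) \<otimes> (z \<oplus> w) [^] Suc n
        = ((c \<otimes> z [^] Suc i) \<otimes> (d \<otimes> w [^] j)) \<otimes> (z \<oplus> w) [^] n
        \<oplus> ((c \<otimes> z [^] i) \<otimes> (d \<otimes> w [^] Suc j)) \<otimes> (z \<oplus> w) [^] n"
    proof -
      have "Z \<otimes> (S \<otimes> (z \<oplus> w)) = (Z \<otimes> z) \<otimes> S \<oplus> (Z \<otimes> w) \<otimes> S"
        if "Z \<in> carrier R" "S \<in> carrier R" for Z S
        using that \<open>z \<in> carrier R\<close> \<open>w \<in> carrier R\<close> by (simp add: r_distr m_ac)
      from this[of "(c \<otimes> z [^] i) \<otimes> (d \<otimes> w [^] j)" "(z \<oplus> w) [^] n"]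
      show ?thesis using that(1-4) E_carr by (simp add: m_ac)
    qed
    show ?case unfolding eq by (rule E_simps(7)[OF Suc Suc])
  qed
  have mult: "x \<otimes> y \<in> ?A" if xy: "x \<in> ?A" "y \<in> ?A" for x y
  proof -
    obtain c d where cd: "c \<in> E - {\<zero>}" "d \<in> E - {\<zero>}"
      "\<forall>n::nat. c \<otimes> x [^] n \<in> E" "\<forall>n::nat. d \<otimes> y [^] n \<in> E" using xy by blast
    have "(c \<otimes> d) \<otimes> (x \<otimes> y) [^] n = (c \<otimes> x [^] n) \<otimes> (d \<otimes> y [^] n)" for n :: nat
      using cd xy E_carr by (simp add: nat_pow_distrib m_ac)
    then have "\<forall>n::nat. (c \<otimes> d) \<otimes> (x \<otimes> y) [^] n \<in> E" using cd E_simps(6) by simp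
    moreover have "c \<otimes> d \<in> E - {\<zero>}" using cd E_simps(6) E_carr by (auto simp: integral_iff)
    ultimately show ?thesis using xy by blast
  qed
  have E_sub: "x \<in> ?A" if "x \<in> E" for x
  proof -
    have "x [^] n \<in> E" for n :: nat using that E_simps by (induction n) auto
    then have "\<forall>n::nat. \<one> \<otimes> x [^] n \<in> E" using that E_carr by simp
    then show ?thesis using that E_carr E_simps(3) by fastforce
  qed
  show ?thesis
  proof (rule subringI)
    show "\<one> \<in> ?A" using E_sub E_simps(3) by blast
    fix x y assume x: "x \<in> ?A"
    have "\<ominus> \<one> \<in> ?A" using E_sub E_simps(3,5) by blast
    then have "\<ominus> \<one> \<otimes> x \<in> ?A" using mult x by blast
    then show "\<ominus> x \<in> ?A" using x by (simp add: l_minus)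
    assume y: "y \<in> ?A"
    show "x \<otimes> y \<in> ?A" by (rule mult[OF x y])
    obtain c d where cd: "c \<in> E - {\<zero>}" "d \<in> E - {\<zero>}"
      "\<forall>n::nat. c \<otimes> x [^] n \<in> E" "\<forall>n::nat. d \<otimes> y [^] n \<in> E" using x y by blast
    have "\<forall>n::nat. (c \<otimes> d) \<otimes> (x \<oplus> y) [^] n \<in> E"
      using sum[of c d x y 0 0] cd x y E_carr by auto
    moreover have "c \<otimes> d \<in> E - {\<zero>}" using cd E_simps(6) E_carr by (auto simp: integral_iff)
    ultimately show "x \<oplus> y \<in> ?A" using x y by blast
  qed auto
qed

lemma complete_integral_closure_subring:
  "subring (carrier (complete_integral_closure R)) (quot_field R)"
proof -
  interpret K: field "quot_field R" by (rule quot_field_field)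
  interpret h: ring_hom_ring R "quot_field R" "quot_embed R"
    by (rule ring_hom_ringI2[OF ring_axioms K.ring_axioms quot_embed_hom])
  have "subring (quot_embed R ` carrier R) (quot_field R)"
    by (rule h.img_is_subring[OF carrier_is_subring])
  from K.almost_integral_subring[OF this] show ?thesis
    by (simp add: complete_integral_closure_def almost_integral_iff)
qed

end

section \<open>The topological condition and its invariance\<close>

text \<open>On a spectrum, \<open>C = V(I)\<close> with \<open>I\<close> finitely generated, and \<open>Z \<subseteq> V(c)\<close> with \<open>c \<noteq> 0\<close>.\<close>

definition star_excluded :: "'a topology \<Rightarrow> 'a \<Rightarrow> bool" where
  "star_excluded T p \<longleftrightarrow> (\<exists>C Z. closedin T C \<and> closedin T Z \<and> p \<in> C \<and>
     compactin T (topspace T - C) \<and> Z \<noteq> topspace T \<and> (\<forall>r\<in>C. \<exists>q\<in>Z - C. r \<in> T closure_of {q}))"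

text \<open>The images of \<open>C\<close> and \<open>Z\<close> are the new witnesses:
  homeomorphisms preserve closedness, compactness and closures of points, and injectivity takes care
  of differences and of properness.\<close>

lemma star_excluded_homeomorphic_image:
  assumes hom: "homeomorphic_map T U f" and "star_excluded T p"
  shows "star_excluded U (f p)"
proof -
  obtain C Z where C: "closedin T C" "closedin T Z" "p \<in> C" "compactin T (topspace T - C)"
    "Z \<noteq> topspace T" "\<forall>r\<in>C. \<exists>q\<in>Z - C. r \<in> T closure_of {q}"
    using assms(2) unfolding star_excluded_def by blast
  have sub: "C \<subseteq> topspace T" "Z \<subseteq> topspace T" using C closedin_subset by auto
  have inj: "inj_on f (topspace T)" by (rule homeomorphic_imp_injective_map[OF hom])
  have img: "f ` topspace T = topspace U" by (rule homeomorphic_imp_surjective_map[OF hom])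
  have diff: "f ` (A - C) = f ` A - f ` C" if "A \<subseteq> topspace T" for A
    by (rule inj_on_image_set_diff[OF inj]) (use that sub in auto)
  show ?thesis
    unfolding star_excluded_def
  proof (intro exI conjI ballI)
    show "closedin U (f ` C)" "closedin U (f ` Z)"
      using C hom sub homeomorphic_map_closedness by blast+
    show "f p \<in> f ` C" using C by blast
    have "compactin U (f ` (topspace T - C))"
      using C hom by (simp add: homeomorphic_map_compactness)
    then show "compactin U (topspace U - f ` C)" using diff[of "topspace T"] img by simp
    show "f ` Z \<noteq> topspace U"
      using C(5) sub inj_on_image_eq_iff[OF inj sub(2) subset_refl] img by simp
    fix r assume "r \<in> f ` C"
    then obtain x q where xq: "x \<in> C" "r = f x" "q \<in> Z - C" "x \<in> T closure_of {q}" using C by blast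
    have "U closure_of (f ` {q}) = f ` (T closure_of {q})"
      using homeomorphic_map_closure_of[OF hom, of "{q}"] xq sub by auto
    then have "r \<in> U closure_of {f q}" using xq by auto
    moreover have "f q \<in> f ` Z - f ` C" using xq diff[OF sub(2)] by blast
    ultimately show "\<exists>y\<in>f ` Z - f ` C. r \<in> U closure_of {y}" by blast
  qed
qed

section \<open>Specialization and quasi-compactness in the Zariski topology\<close>

context cring
begin

text \<open>The closure of a point is the closed set cut out by that prime itself. Thus inclusion of
  primes is visible to the topology.\<close>

lemma in_zariski_closure_of_singleton_iff:
  assumes "Q \<in> Spec R"
  shows "P \<in> zariski_topology R closure_of {Q} \<longleftrightarrow> P \<in> Spec R \<and> Q \<subseteq> P"
proof
  assume "P \<in> zariski_topology R closure_of {Q}"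
  moreover have "closedin (zariski_topology R) (zariski_closed R Q)"
    using Spec_subset[OF assms] closedin_zariski by blast
  ultimately have "P \<in> zariski_closed R Q"
    using closure_of_minimal[of "{Q}" "zariski_closed R Q"] assms
    by (auto simp: zariski_closed_def)
  then show "P \<in> Spec R \<and> Q \<subseteq> P" by (simp add: zariski_closed_def)
next
  assume "P \<in> Spec R \<and> Q \<subseteq> P"
  then show "P \<in> zariski_topology R closure_of {Q}"
    using assms by (auto simp: in_closure_of topspace_zariski openin_zariski zariski_closed_def)
qed

lemma Spec_minus_zariski_closed:
  "Spec R - zariski_closed R S = (\<Union>s\<in>S. Spec R - zariski_closed R {s})"
  by (auto simp: zariski_closed_def)

text \<open>The \<open>x\<close> whose basic open set has a finite subcover form an ideal
  \<open>?J\<close>. If it lacked \<open>a\<close>, it would lack every power of \<open>a\<close>,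
  as the basic open set of \<open>a\<close> lies in that of each power. Some prime above
  \<open>?J\<close> would then avoid all powers of \<open>a\<close>, and so be a point of the set
  being covered.\<close>

lemma basic_open_compactin:
  assumes a: "a \<in> carrier R"
  shows "compactin (zariski_topology R) (Spec R - zariski_closed R {a})"
  unfolding compactin_def topspace_zariski
proof (intro conjI allI impI)
  fix \<U> assume U: "(\<forall>U\<in>\<U>. openin (zariski_topology R) U) \<and> Spec R - zariski_closed R {a} \<subseteq> \<Union>\<U>"
  let ?D = "\<lambda>x. Spec R - zariski_closed R {x}"
  define cov where "cov W \<longleftrightarrow> (\<exists>\<F>. finite \<F> \<and> \<F> \<subseteq> \<U> \<and> W \<subseteq> \<Union>\<F>)" for W
  have cov_mono: "cov V" if "cov W" "V \<subseteq> W" for V W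
    using that unfolding cov_def by (meson subset_trans)
  have cov_Un: "cov (V \<union> W)" if "cov V" "cov W" for V W
  proof -
    obtain \<F> \<G> where "finite \<F>" "\<F> \<subseteq> \<U>" "V \<subseteq> \<Union>\<F>" "finite \<G>" "\<G> \<subseteq> \<U>" "W \<subseteq> \<Union>\<G>"
      using \<open>cov V\<close> \<open>cov W\<close> unfolding cov_def by blast
    then show ?thesis unfolding cov_def by (intro exI[of _ "\<F> \<union> \<G>"]) auto
  qed
  have cov_empty: "cov {}" unfolding cov_def by (intro exI[of _ "{}"]) simp
  have cov_mem: "cov V" if "V \<in> \<U>" for V unfolding cov_def using that by (intro exI[of _ "{V}"]) simp
  have D_mem: "P \<in> ?D x \<longleftrightarrow> P \<in> Spec R \<and> x \<notin> P" for x P by (auto simp: zariski_closed_def)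
  let ?J = "{x \<in> carrier R. cov (?D x)}"
  have J: "ideal ?J R"
  proof (rule ideal_cringI)
    have "?D \<zero> \<subseteq> {}" using Spec_zero[of _ R] D_mem by blast
    then show "\<zero> \<in> ?J" using cov_mono[OF cov_empty, of "?D \<zero>"] by simp
    fix x y assume xy: "x \<in> ?J" "y \<in> ?J"
    then have "cov (?D x \<union> ?D y)" using cov_Un by simp
    moreover have "?D (x \<oplus> y) \<subseteq> ?D x \<union> ?D y" using Spec_add[of _ R x y] D_mem by blast
    ultimately have "cov (?D (x \<oplus> y))" by (rule cov_mono)
    then show "x \<oplus> y \<in> ?J" using xy by simp
  next
    fix x y assume xy: "x \<in> carrier R" "y \<in> ?J"
    then have "cov (?D y)" by simp
    moreover have "?D (x \<otimes> y) \<subseteq> ?D y" using Spec_mult_mem_iff[of _ R x y] xy D_mem by blast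
    ultimately have "cov (?D (x \<otimes> y))" by (rule cov_mono)
    then show "x \<otimes> y \<in> ?J" using xy by simp
  qed auto
  have "a \<in> ?J"
  proof (rule ccontr)
    assume "a \<notin> ?J"
    let ?S = "range (\<lambda>n::nat. a [^] n)"
    have "a [^] n \<notin> ?J" for n :: nat
    proof
      assume "a [^] n \<in> ?J"
      then have "cov (?D (a [^] n))" by simp
      moreover have "?D a \<subseteq> ?D (a [^] n)" using Spec_pow_mem[OF _ a] D_mem by blast
      ultimately have "cov (?D a)" by (rule cov_mono)
      then show False using \<open>a \<notin> ?J\<close> a by simp
    qed
    then have disj: "?J \<inter> ?S = {}" by blast
    have one: "\<one> \<in> ?S" by (intro range_eqI[of _ _ 0]) simp
    have mult: "x \<otimes> y \<in> ?S" if "x \<in> ?S" "y \<in> ?S" for x y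
      using that a by (auto simp: nat_pow_mult)
    have "?S \<subseteq> carrier R" using a by auto
    then obtain P where P: "P \<in> Spec R" "?J \<subseteq> P" "P \<inter> ?S = {}"
      by (rule prime_separation[OF J _ one disj mult])
    have "a \<in> ?S" using a by (intro range_eqI[of _ _ 1]) simp
    then have "P \<in> ?D a" using P D_mem by blast
    then obtain V where V: "V \<in> \<U>" "P \<in> V" using U by blast
    \<comment> \<open>Some basic open set around \<open>P\<close> lies inside \<open>V\<close>, so
      \<open>V\<close> alone covers it. Its \<open>s\<close> is then in \<open>?J\<close>, hence in
      \<open>P\<close>, a contradiction.\<close>
    have "openin (zariski_topology R) V" using U V(1) by blast
    then obtain S where S: "S \<subseteq> carrier R" "V = Spec R - zariski_closed R S"
      unfolding openin_zariski by blast
    then obtain s where s: "s \<in> S" "s \<notin> P" using V(2) by (auto simp: zariski_closed_def)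
    then have "?D s \<subseteq> V" using S by (auto simp: zariski_closed_def)
    then have "cov (?D s)" by (rule cov_mono[OF cov_mem[OF V(1)]])
    then have "s \<in> ?J" using s(1) S(1) by (simp add: subset_iff)
    then show False using P s by blast
  qed
  then show "\<exists>\<F>. finite \<F> \<and> \<F> \<subseteq> \<U> \<and> ?D a \<subseteq> \<Union>\<F>" by (simp add: cov_def)
qed auto

text \<open>The basic open sets of elements of \<open>S\<close> cover the complement, and a finite
  subcover names \<open>F\<close>. This recovers a finitely generated ideal from a topological
  hypothesis.\<close>

lemma quasicompact_complement_finite:
  assumes S: "S \<subseteq> carrier R"
    and comp: "compactin (zariski_topology R) (Spec R - zariski_closed R S)"
  obtains F where "finite F" "F \<subseteq> S" "zariski_closed R F = zariski_closed R S"
proof -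
  let ?D = "\<lambda>x. Spec R - zariski_closed R {x}"
  have "openin (zariski_topology R) U" if U: "U \<in> ?D ` S" for U
  proof -
    obtain x where "x \<in> S" "U = ?D x" using U by blast
    then show ?thesis unfolding openin_zariski using S by (intro exI[of _ "{x}"]) auto
  qed
  from compactinD[OF comp this, of "?D ` S"] obtain \<F> where F: "finite \<F>" "\<F> \<subseteq> ?D ` S"
    "Spec R - zariski_closed R S \<subseteq> \<Union>\<F>" using Spec_minus_zariski_closed[of S] by blast
  then obtain F where "F \<subseteq> S" "finite F" "\<F> = ?D ` F" by (meson finite_subset_image)
  moreover from this have "zariski_closed R F = zariski_closed R S"
    using F(3) by (auto simp: zariski_closed_def)
  ultimately show thesis using that by blast
qed

end

section \<open>Denominators and the localization criterion for \<open>Spec_star\<close>\<close>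

context "domain"
begin

text \<open>For \<open>z = a/b\<close> this says that \<open>i + z j = 1\<close> for some \<open>i, j\<close> in the ideal \<open>(D : z)\<close>.\<close>

lemma prufer_denominators:
  assumes pr: "prufer_domain R" and ab: "a \<in> carrier R" "b \<in> carrier R"
  obtains i j where "i \<in> carrier R" "j \<in> carrier R" "b divides i \<otimes> a" "b divides j \<otimes> a"
    "b = b \<otimes> i \<oplus> a \<otimes> j"
proof -
  \<comment> \<open>The last equation is \<open>x = i + z j\<close> multiplied by \<open>b\<close>.
    Such \<open>x\<close> form an ideal, and it remains to see that no prime contains it.\<close>
  let ?W = "\<lambda>x i j. i \<in> carrier R \<and> j \<in> carrier R \<and> b divides i \<otimes> a \<and> b divides j \<otimes> a \<and>
    b \<otimes> x = b \<otimes> i \<oplus> a \<otimes> j"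
  let ?J = "{x \<in> carrier R. \<exists>i j. ?W x i j}"
  have zero: "b divides \<zero> \<otimes> a" using ab by (auto intro!: dividesI[of \<zero>])
  have "ideal ?J R"
  proof (rule ideal_cringI)
    have "?W \<zero> \<zero> \<zero>" using ab zero by simp
    then show "\<zero> \<in> ?J" by blast
  next
    fix x y assume xy: "x \<in> ?J" "y \<in> ?J"
    then obtain i j k l where w: "?W x i j" "?W y k l" by blast
    have add: "b divides (c \<oplus> d) \<otimes> a"
      if cd: "c \<in> carrier R" "d \<in> carrier R" "b divides c \<otimes> a" "b divides d \<otimes> a" for c d
    proof -
      obtain v w where "v \<in> carrier R" "c \<otimes> a = b \<otimes> v" "w \<in> carrier R" "d \<otimes> a = b \<otimes> w"
        using cd(3,4) by (auto elim!: dividesE)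
      then show ?thesis
        using cd ab by (auto simp: l_distr r_distr[symmetric] intro!: dividesI[of "v \<oplus> w"])
    qed
    have "b \<otimes> (x \<oplus> y) = (b \<otimes> i \<oplus> a \<otimes> j) \<oplus> (b \<otimes> k \<oplus> a \<otimes> l)"
      using w xy ab by (simp add: r_distr)
    also have "\<dots> = b \<otimes> (i \<oplus> k) \<oplus> a \<otimes> (j \<oplus> l)" using w ab by (simp add: r_distr a_ac)
    finally have "?W (x \<oplus> y) (i \<oplus> k) (j \<oplus> l)" using w add by simp
    then show "x \<oplus> y \<in> ?J" using xy by blast
  next
    fix x y assume xy: "x \<in> carrier R" "y \<in> ?J"
    then obtain i j where w: "?W y i j" by blast
    have mult: "b divides (x \<otimes> c) \<otimes> a" if c: "c \<in> carrier R" "b divides c \<otimes> a" for c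
    proof -
      obtain v where "v \<in> carrier R" "c \<otimes> a = b \<otimes> v" using c by (auto elim!: dividesE)
      moreover from this have "(x \<otimes> c) \<otimes> a = b \<otimes> (x \<otimes> v)"
        using xy c ab by (simp add: m_assoc m_lcomm)
      ultimately show ?thesis using xy by (auto intro!: dividesI[of "x \<otimes> v"])
    qed
    have "b \<otimes> (x \<otimes> y) = x \<otimes> (b \<otimes> y)" using xy ab by (simp add: m_lcomm)
    also have "b \<otimes> y = b \<otimes> i \<oplus> a \<otimes> j" using w by blast
    also have "x \<otimes> (b \<otimes> i \<oplus> a \<otimes> j) = b \<otimes> (x \<otimes> i) \<oplus> a \<otimes> (x \<otimes> j)" using w xy ab by (simp add: r_distr m_lcomm)
    finally have "?W (x \<otimes> y) (x \<otimes> i) (x \<otimes> j)" using w xy mult by simp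
    then show "x \<otimes> y \<in> ?J" using xy by blast
  qed auto
  have "\<one> \<in> ?J"
  proof (rule ccontr)
    assume "\<one> \<notin> ?J"
    then obtain P where P: "P \<in> Spec R" "?J \<subseteq> P"
      using ideal_subset_prime[OF \<open>ideal ?J R\<close>] by blast
    obtain u where u: "u \<in> carrier R - P" "a divides u \<otimes> b \<or> b divides u \<otimes> a"
      using prufer_locally_comparable[OF pr P(1) ab] by blast
    \<comment> \<open>If \<open>b\<close> divides \<open>u a\<close>, the pair \<open>(u, 0)\<close>
      works. If \<open>u b = a t\<close>, then \<open>t a = b u\<close> as well, and
      \<open>(0, t)\<close> works.\<close>
    have "u \<in> ?J"
      using u(2)
    proof
      assume "b divides u \<otimes> a"
      then have "?W u u \<zero>" using u ab zero by simp
      then show ?thesis using u by blast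
    next
      assume "a divides u \<otimes> b"
      then obtain t where t: "t \<in> carrier R" "u \<otimes> b = a \<otimes> t" by (auto elim!: dividesE)
      then have "t \<otimes> a = b \<otimes> u" using u ab by (simp add: m_comm)
      then have "?W u \<zero> t" using u ab zero t by (auto simp: m_comm intro: dividesI[of u])
      then show ?thesis using u by blast
    qed
    then show False using u P by blast
  qed
  then show thesis using that ab by auto
qed

text \<open>For \<open>z\<close> almost integral but outside the localization, the
  \<open>i, j\<close> of \<open>prufer_denominators\<close> lie in \<open>P\<close>, and
  \<open>\<one> = i + z j\<close> is in the extended ideal. Conversely, if there is no such
  \<open>z\<close>, the extension of \<open>P\<close> stays inside the maximal ideal of the
  localization.\<close>

lemma Spec_star_iff:
  assumes pr: "prufer_domain R" and P: "P \<in> Spec R"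
  shows "P \<in> Spec_star R \<longleftrightarrow> (\<forall>z. almost_integral R z \<longrightarrow> z \<in> carrier (localization_at R P))"
proof -
  interpret K: field "quot_field R" by (rule quot_field_field)
  let ?T = "complete_integral_closure R"
  have T_carr: "z \<in> carrier ?T \<longleftrightarrow> almost_integral R z" for z
    by (simp add: complete_integral_closure_def)
  have T_ops: "x \<otimes>\<^bsub>?T\<^esub> y = x \<otimes>\<^bsub>quot_field R\<^esub> y" "x \<oplus>\<^bsub>?T\<^esub> y = x \<oplus>\<^bsub>quot_field R\<^esub> y"
    "\<one>\<^bsub>?T\<^esub> = fraction R \<one> \<one>" "\<zero>\<^bsub>?T\<^esub> = fraction R \<zero> \<one>" for x y
    by (simp_all add: complete_integral_closure_def quot_field_simps(2,3))
  have "cring (quot_field R\<lparr>carrier := carrier ?T\<rparr>)"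
    using K.subcring_iff K.subcringI'[OF complete_integral_closure_subring]
      subringE(1)[OF complete_integral_closure_subring] by blast
  then interpret T: cring ?T by (simp add: complete_integral_closure_def)
  have emb: "quot_embed R ` P \<subseteq> carrier ?T"
  proof -
    have "almost_integral R (fraction R p \<one>)" if p: "p \<in> carrier R" for p
    proof -
      have "\<one> [^] n divides \<one> \<otimes> p [^] n" for n :: nat
        using p by (intro dividesI[of "p [^] n"]) auto
      then show ?thesis
        using p by (subst almost_integral_fraction_iff) (auto intro!: bexI[of _ \<one>])
    qed
    then show ?thesis using Spec_subset[OF P] by (auto simp: T_carr quot_embed_def)
  qed
  show ?thesis
  proof
    assume star: "P \<in> Spec_star R"
    show "\<forall>z. almost_integral R z \<longrightarrow> z \<in> carrier (localization_at R P)"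
    proof (intro allI impI, rule ccontr)
      fix z assume z: "almost_integral R z" "z \<notin> carrier (localization_at R P)"
      have "z \<in> carrier (quot_field R)" using z(1) by (simp add: almost_integral_def)
      then obtain a b where ab: "a \<in> carrier R" "b \<in> carrier R" "b \<noteq> \<zero>" "z = fraction R a b"
        by (rule quot_field_cases)
      obtain i j where ij: "i \<in> carrier R" "j \<in> carrier R" "b divides i \<otimes> a" "b divides j \<otimes> a"
        "b = b \<otimes> i \<oplus> a \<otimes> j"
        using prufer_denominators[OF pr ab(1,2)] .
      \<comment> \<open>Either one outside \<open>P\<close> would serve as a denominator putting
        \<open>z\<close> into the localization.\<close>
      have ijP: "i \<in> P" "j \<in> P"
        using z(2) ij ab fraction_mem_localization_iff[OF P ab(1-3)] by blast+
      interpret I: ideal "Idl\<^bsub>?T\<^esub> (quot_embed R ` P)" ?T by (rule T.genideal_ideal[OF emb])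
      have mem: "quot_embed R p \<in> Idl\<^bsub>?T\<^esub> (quot_embed R ` P)" if "p \<in> P" for p
        using T.genideal_self[OF emb] that by blast
      have "quot_embed R i \<oplus>\<^bsub>?T\<^esub> z \<otimes>\<^bsub>?T\<^esub> quot_embed R j \<in> Idl\<^bsub>?T\<^esub> (quot_embed R ` P)"
        using mem ijP z(1) by (intro I.a_closed I.I_l_closed) (auto simp: T_carr)
      moreover have "quot_embed R i \<oplus>\<^bsub>?T\<^esub> z \<otimes>\<^bsub>?T\<^esub> quot_embed R j = \<one>\<^bsub>?T\<^esub>"
      proof -
        have "i \<otimes> b \<oplus> a \<otimes> j = b" using ij ab by (simp add: m_comm)
        then show ?thesis using ij(1,2) ab
          by (simp add: T_ops quot_embed_def quot_field_mult quot_field_add fraction_eq_iff)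
      qed
      ultimately show False using star I.one_imp_carrier by (simp add: Spec_star_def)
    qed
  next
    assume sub: "\<forall>z. almost_integral R z \<longrightarrow> z \<in> carrier (localization_at R P)"
    \<comment> \<open>The contraction of the maximal ideal of \<open>R\<^sub>P\<close> to
      \<open>?T\<close>. Absorption holds because \<open>sub\<close> provides elements of
      \<open>?T\<close> with denominators outside \<open>P\<close>.\<close>
    let ?M = "{z \<in> carrier ?T. \<exists>p\<in>P. \<exists>s\<in>carrier R - P. z = fraction R p s}"
    note P_carr = Spec_subset[OF P, THEN subsetD]
    have nz: "s \<noteq> \<zero>" if "s \<in> carrier R - P" for s using that Spec_zero[OF P] by auto
    have P_mult: "a \<otimes> b \<in> P \<longleftrightarrow> a \<in> P \<or> b \<in> P" if "a \<in> carrier R" "b \<in> carrier R" for a b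
      by (rule Spec_mult_mem_iff[OF P that])
    have "ideal ?M ?T"
    proof (rule T.ideal_cringI)
      show "\<zero>\<^bsub>?T\<^esub> \<in> ?M" using T.zero_closed Spec_zero[OF P] Spec_one[OF P] by (auto simp: T_ops)
      fix x y assume xy: "x \<in> ?M" "y \<in> ?M"
      then obtain p s q t where w: "p \<in> P" "s \<in> carrier R - P" "x = fraction R p s"
        "q \<in> P" "t \<in> carrier R - P" "y = fraction R q t" by blast
      then have "x \<oplus>\<^bsub>?T\<^esub> y = fraction R (p \<otimes> t \<oplus> q \<otimes> s) (s \<otimes> t)"
        using nz P_carr by (simp add: T_ops quot_field_add)
      moreover have "p \<otimes> t \<oplus> q \<otimes> s \<in> P" "s \<otimes> t \<in> carrier R - P"
        using w P_carr P_mult by (auto intro: Spec_add[OF P])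
      ultimately show "x \<oplus>\<^bsub>?T\<^esub> y \<in> ?M" using xy by blast
    next
      fix x y assume xy: "x \<in> carrier ?T" "y \<in> ?M"
      then obtain a s where x: "a \<in> carrier R" "s \<in> carrier R - P" "x = fraction R a s"
        using sub by (auto simp: T_carr localization_at_def)
      obtain q t where y: "q \<in> P" "t \<in> carrier R - P" "y = fraction R q t" using xy by blast
      have "x \<otimes>\<^bsub>?T\<^esub> y = fraction R (a \<otimes> q) (s \<otimes> t)"
        using x y nz P_carr by (simp add: T_ops quot_field_mult)
      moreover have "a \<otimes> q \<in> P" "s \<otimes> t \<in> carrier R - P" using x y P_carr P_mult by auto
      ultimately show "x \<otimes>\<^bsub>?T\<^esub> y \<in> ?M" using xy by blast
    qed auto
    moreover have "quot_embed R ` P \<subseteq> ?M"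
      using emb Spec_one[OF P] by (auto simp: quot_embed_def)
    ultimately have "Idl\<^bsub>?T\<^esub> (quot_embed R ` P) \<subseteq> ?M" by (rule T.genideal_minimal)
    moreover have "\<one>\<^bsub>?T\<^esub> \<notin> ?M"
    proof
      assume "\<one>\<^bsub>?T\<^esub> \<in> ?M"
      then obtain p s where ps: "p \<in> P" "s \<in> carrier R - P" "fraction R \<one> \<one> = fraction R p s"
        by (auto simp: T_ops)
      then have "s = p" using nz P_carr by (simp add: fraction_eq_iff)
      then show False using ps by blast
    qed
    ultimately have "Idl\<^bsub>?T\<^esub> (quot_embed R ` P) \<noteq> carrier ?T" using T.one_closed by blast
    then show "P \<in> Spec_star R" using P by (simp add: Spec_star_def)
  qed
qed

section \<open>The topological description of \<open>Spec_star\<close>\<close>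

text \<open>Choose \<open>z\<close> almost integral but outside the localization at
  \<open>P\<close>. Then \<open>Z\<close> is cut out by a multiplier \<open>c\<close> for all powers
  of \<open>z\<close>, and \<open>C\<close> by two denominators \<open>i, j\<close> with
  \<open>i + z j = 1\<close>.\<close>

lemma star_excluded_if_almost_integral:
  assumes pr: "prufer_domain R" and P: "P \<in> Spec R" and star: "P \<notin> Spec_star R"
  shows "star_excluded (zariski_topology R) P"
proof -
  obtain z where z: "almost_integral R z" "z \<notin> carrier (localization_at R P)"
    using Spec_star_iff[OF pr P] star by blast
  have "z \<in> carrier (quot_field R)" using z(1) by (simp add: almost_integral_def)
  then obtain a b where ab: "a \<in> carrier R" "b \<in> carrier R" "b \<noteq> \<zero>" "z = fraction R a b"
    by (rule quot_field_cases)
  obtain c where c: "c \<in> carrier R" "c \<noteq> \<zero>" "\<And>n::nat. b [^] n divides c \<otimes> a [^] n"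
    using z(1) unfolding ab(4) almost_integral_fraction_iff[OF ab(1-3)] by blast
  obtain i j where ij: "i \<in> carrier R" "j \<in> carrier R" "b divides i \<otimes> a" "b divides j \<otimes> a"
    "b = b \<otimes> i \<oplus> a \<otimes> j"
    using prufer_denominators[OF pr ab(1,2)] .
  have ijP: "i \<in> P" "j \<in> P"
    using z(2) ij ab fraction_mem_localization_iff[OF P ab(1-3)] by blast+
  \<comment> \<open>Here \<open>v\<close> is \<open>z j\<close>, so \<open>one\<close> reads
    \<open>i + z j = 1\<close>, and \<open>pow_dvd\<close> is the membership of \<open>c z^n\<close>
    in \<open>R\<close> multiplied by \<open>j^n\<close>.\<close>
  obtain v where v: "v \<in> carrier R" "j \<otimes> a = b \<otimes> v" using ij(4) by (auto elim!: dividesE)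
  have one: "i \<oplus> v = \<one>"
  proof -
    have "b \<otimes> (i \<oplus> v) = b \<otimes> \<one>" using ij v ab by (simp add: r_distr m_comm)
    then show ?thesis using m_lcancel[of b "i \<oplus> v" \<one>] ab ij v by simp
  qed
  have pow_dvd: "j [^] n divides c \<otimes> v [^] n" for n :: nat
  proof -
    obtain d where d: "d \<in> carrier R" "c \<otimes> a [^] n = b [^] n \<otimes> d" using c(3)[of n] by (auto elim!: dividesE)
    have "b [^] n \<otimes> (c \<otimes> v [^] n) = c \<otimes> (b \<otimes> v) [^] n"
      using c ab v by (simp add: nat_pow_distrib m_lcomm)
    also have "\<dots> = j [^] n \<otimes> (c \<otimes> a [^] n)"
      unfolding v(2)[symmetric] using c ab ij by (simp add: nat_pow_distrib m_lcomm)
    also have "\<dots> = b [^] n \<otimes> (j [^] n \<otimes> d)" using d ab ij by (simp add: m_lcomm)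
    finally have "c \<otimes> v [^] n = j [^] n \<otimes> d"
      using m_lcancel[of "b [^] n" "c \<otimes> v [^] n" "j [^] n \<otimes> d"] fraction_pow[OF ab(1-3), of n] c v ab ij d
      by simp
    then show ?thesis using d by blast
  qed
  let ?C = "zariski_closed R {i, j}" and ?Z = "zariski_closed R {c}"
  show ?thesis
    unfolding star_excluded_def topspace_zariski
  proof (intro exI conjI ballI)
    show "closedin (zariski_topology R) ?C" "closedin (zariski_topology R) ?Z"
      unfolding closedin_zariski
      using ij(1,2) c(1) by (intro exI[of _ "{i, j}"] exI[of _ "{c}"]; simp)+
    show "P \<in> ?C" using P ijP by (simp add: zariski_closed_def)
    have "Spec R - ?C = (Spec R - zariski_closed R {i}) \<union> (Spec R - zariski_closed R {j})"
      by (auto simp: zariski_closed_def)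
    then show "compactin (zariski_topology R) (Spec R - ?C)"
      using ij by (simp add: compactin_Un basic_open_compactin)
    have "{\<zero>} \<in> Spec R" using zeroprimeideal by (simp add: Spec_def)
    then show "?Z \<noteq> Spec R" using c by (auto simp: zariski_closed_def)
    fix Q assume "Q \<in> ?C"
    then have Q: "Q \<in> Spec R" "i \<in> Q" "j \<in> Q" by (auto simp: zariski_closed_def)
    have vQ: "v \<notin> Q" using Q one Spec_add[OF Q(1), of i v] Spec_one[OF Q(1)] by auto
    have j0: "j \<noteq> \<zero>"
    proof
      assume "j = \<zero>"
      then have "b \<otimes> v = \<zero>" using v(2)[symmetric] ab(1) by simp
      then have "v = \<zero>" using integral_iff v(1) ab(2,3) by blast
      then show False using vQ Spec_zero[OF Q(1)] by simp
    qed
    have mult_Q: "x \<otimes> y \<in> carrier R - Q" if "x \<in> carrier R - Q" "y \<in> carrier R - Q" for x y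
      using that Spec_mult_mem_iff[OF Q(1)] by auto
    \<comment> \<open>Here \<open>j\<close> generates \<open>(D : z)\<close> at \<open>Q\<close>, as \<open>v = z j\<close> is a unit there. A prime through \<open>c\<close>
      avoiding \<open>?S\<close> exists: \<open>t c = j\<^sup>n s\<close> and \<open>j\<^sup>n\<^sup>+\<^sup>1\<close> dividing \<open>c v\<^sup>n\<^sup>+\<^sup>1\<close> would make \<open>j\<close> divide \<open>s v\<^sup>n\<^sup>+\<^sup>1 \<notin> Q\<close>.\<close>
    let ?S = "{j [^] n \<otimes> s | (n::nat) s. s \<in> carrier R - Q}"
    have S: "j [^] n \<otimes> s \<in> ?S" if "s \<in> carrier R - Q" for s and n :: nat using that by blast
    have oneQ: "\<one> \<in> carrier R - Q" using Spec_one[OF Q(1)] by simp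
    have "PIdl c \<inter> ?S = {}"
    proof (rule ccontr)
      assume "PIdl c \<inter> ?S \<noteq> {}"
      then obtain n t s where *: "t \<in> carrier R" "s \<in> carrier R - Q" "t \<otimes> c = j [^] (n::nat) \<otimes> s"
        by (auto simp: cgenideal_def)
      obtain d where d: "d \<in> carrier R" "c \<otimes> v [^] Suc n = j [^] Suc n \<otimes> d"
        using pow_dvd[of "Suc n"] by (auto elim!: dividesE)
      have "j [^] n \<otimes> (s \<otimes> v [^] Suc n) = (t \<otimes> c) \<otimes> v [^] Suc n"
        unfolding *(3) using *(2) v(1) ij(2) by (simp add: m_assoc)
      also have "\<dots> = t \<otimes> (j [^] Suc n \<otimes> d)" unfolding d(2)[symmetric] using *(1) c(1) v(1) by (simp add: m_assoc)
      also have "\<dots> = j [^] n \<otimes> (j \<otimes> (t \<otimes> d))" using * d ij by (simp add: m_ac)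
      finally have "s \<otimes> v [^] Suc n = j \<otimes> (t \<otimes> d)"
        using m_lcancel[of "j [^] n" "s \<otimes> v [^] Suc n" "j \<otimes> (t \<otimes> d)"]
          fraction_pow[OF ab(1) ij(2) j0, of n] * v ij d by (simp del: nat_pow_Suc)
      moreover have "j \<otimes> (t \<otimes> d) \<in> Q" using Spec_mult_mem_iff[OF Q(1)] Q ij * d by simp
      moreover have "s \<otimes> v [^] Suc n \<notin> Q"
        using Spec_mult_mem_iff[OF Q(1), of s "v [^] Suc n"] Spec_pow_mem[OF Q(1) v(1), of "Suc n"] vQ * v
        by (auto simp del: nat_pow_Suc)
      ultimately show False by simp
    qed
    moreover have "\<one> \<in> ?S" using S[OF oneQ, of 0] by simp
    moreover have "x \<otimes> y \<in> ?S" if S_xy: "x \<in> ?S" "y \<in> ?S" for x y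
    proof -
      obtain m n s t where xy: "x = j [^] (m::nat) \<otimes> s" "y = j [^] (n::nat) \<otimes> t"
        "s \<in> carrier R - Q" "t \<in> carrier R - Q" using S_xy by blast
      have "x \<otimes> y = j [^] (m + n) \<otimes> (s \<otimes> t)" using xy ij by (simp add: nat_pow_mult[symmetric] m_ac)
      then show ?thesis using S[OF mult_Q[OF xy(3,4)]] by simp
    qed
    moreover have "?S \<subseteq> carrier R" using ij by auto
    ultimately obtain N where N: "N \<in> Spec R" "PIdl c \<subseteq> N" "N \<inter> ?S = {}"
      using prime_separation[OF cgenideal_ideal[OF c(1)], of ?S] by blast
    \<comment> \<open>\<open>N\<close> avoids \<open>j\<close> because \<open>j\<close> is in
      \<open>?S\<close> (\<open>n = 1\<close>, \<open>s = \<one>\<close>), and lies in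
      \<open>Q\<close> because \<open>?S\<close> contains everything outside \<open>Q\<close>
      (\<open>n = 0\<close>).\<close>
    have "c \<in> N" using N(2) cgenideal_self[OF c(1)] by blast
    moreover have "j \<notin> N" using S[OF oneQ, of 1] ij N(3) by auto
    moreover have "N \<subseteq> Q"
    proof
      fix x assume "x \<in> N"
      then show "x \<in> Q" using S[of x 0] Spec_subset[OF N(1)] N(3) by auto
    qed
    ultimately show "\<exists>N\<in>?Z - ?C. Q \<in> zariski_topology R closure_of {N}"
      using N(1) Q(1) by (intro bexI[of _ N])
        (auto simp: in_zariski_closure_of_singleton_iff zariski_closed_def)
  qed
qed

text \<open>In a valuation domain one of finitely many elements divides all the others;
  \<open>u\<close> collects the denominators that arise. Taking the generator from \<open>F\<close>
  itself lets later steps apply to it what is known of \<open>F\<close>.\<close>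

lemma prufer_locally_principal:
  assumes pr: "prufer_domain R" and P: "P \<in> Spec R"
    and F: "finite F" "F \<noteq> {}" "F \<subseteq> carrier R"
  obtains y u where "y \<in> F" "u \<in> carrier R - P" "\<forall>f\<in>F. y divides u \<otimes> f"
proof -
  have mult_P: "x \<otimes> y \<in> carrier R - P" if "x \<in> carrier R - P" "y \<in> carrier R - P" for x y
    using that Spec_mult_mem_iff[OF P] by auto
  have dvd_mult: "y divides (v \<otimes> u) \<otimes> f"
    if h: "y divides u \<otimes> f" "y \<in> carrier R" "u \<in> carrier R" "v \<in> carrier R" "f \<in> carrier R" for u v f y
  proof -
    obtain t where "t \<in> carrier R" "u \<otimes> f = y \<otimes> t" using h(1) by (auto elim!: dividesE)
    moreover from this have "(v \<otimes> u) \<otimes> f = y \<otimes> (v \<otimes> t)" using h by (simp add: m_assoc m_lcomm)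
    ultimately show ?thesis using h by (auto intro!: dividesI[of "v \<otimes> t"])
  qed
  have "\<exists>y\<in>F. \<exists>u\<in>carrier R - P. \<forall>f\<in>F. y divides u \<otimes> f"
    using F
  proof (induction F rule: finite_ne_induct)
    case (singleton x)
    then show ?case using Spec_one[OF P] by (auto intro!: bexI[of _ \<one>])
  next
    case (insert x F)
    then obtain y u where yu: "y \<in> F" "u \<in> carrier R - P" "\<forall>f\<in>F. y divides u \<otimes> f" by auto
    have carr: "x \<in> carrier R" "y \<in> carrier R" "F \<subseteq> carrier R" using insert yu by auto
    obtain w where w: "w \<in> carrier R - P" "x divides w \<otimes> y \<or> y divides w \<otimes> x"
      using prufer_locally_comparable[OF pr P carr(1,2)] by blast
    from w(2) show ?case
    proof
      assume x: "x divides w \<otimes> y"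
      have "x divides (w \<otimes> u) \<otimes> f" if f: "f \<in> F" for f
      proof -
        obtain t where t: "t \<in> carrier R" "u \<otimes> f = y \<otimes> t" using yu f by (auto elim!: dividesE)
        obtain r where r: "r \<in> carrier R" "w \<otimes> y = x \<otimes> r" using x by (auto elim!: dividesE)
        have "(w \<otimes> u) \<otimes> f = w \<otimes> (u \<otimes> f)" using w yu carr f by (simp add: m_assoc subset_iff)
        also have "\<dots> = (w \<otimes> y) \<otimes> t" unfolding t(2) using w carr t by (simp add: m_assoc)
        also have "\<dots> = x \<otimes> (r \<otimes> t)" unfolding r(2) using r t carr by (simp add: m_assoc)
        finally show ?thesis using r t by (auto intro!: dividesI[of "r \<otimes> t"])
      qed
      moreover have "x divides (w \<otimes> u) \<otimes> x" using w yu carr by (auto intro!: dividesI[of "w \<otimes> u"] m_comm)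
      ultimately show ?thesis using mult_P[OF w(1) yu(2)] by (intro bexI[of _ x] bexI[of _ "w \<otimes> u"]) auto
    next
      assume y: "y divides w \<otimes> x"
      have "y divides (w \<otimes> u) \<otimes> f" if f: "f \<in> F" for f
        using yu f w carr by (intro dvd_mult) auto
      moreover have "y divides (w \<otimes> u) \<otimes> x"
        using dvd_mult[OF y, of u] yu w carr by (simp add: m_comm[of u w])
      ultimately show ?thesis
        using mult_P[OF w(1) yu(2)] yu(1) by (intro bexI[of _ y] bexI[of _ "w \<otimes> u"]) auto
    qed
  qed
  then show thesis using that by blast
qed

text \<open>Compactness turns \<open>C\<close> into the primes above a finite set \<open>F\<close>,
  and properness of \<open>Z\<close> gives a nonzero \<open>c\<close> common to all primes in
  \<open>Z\<close>. Inverting a generator of \<open>F\<close> at \<open>P\<close> yields an almost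
  integral element outside the localization.\<close>

lemma not_in_Spec_star_if_star_excluded:
  assumes pr: "prufer_domain R" and P: "P \<in> Spec R"
    and excl: "star_excluded (zariski_topology R) P"
  shows "P \<notin> Spec_star R"
proof -
  let ?T = "zariski_topology R"
  obtain C Z where C: "closedin ?T C" "closedin ?T Z" "P \<in> C" "compactin ?T (Spec R - C)"
    "Z \<noteq> Spec R" "\<forall>Q\<in>C. \<exists>N\<in>Z - C. Q \<in> ?T closure_of {N}"
    using excl unfolding star_excluded_def topspace_zariski by blast
  obtain S where S: "S \<subseteq> carrier R" "C = zariski_closed R S" using C(1) closedin_zariski by blast
  obtain F where F: "finite F" "F \<subseteq> S" "zariski_closed R F = C"
    using quasicompact_complement_finite[OF S(1)] C(4) S(2) by blast
  have F_carr: "F \<subseteq> carrier R" using F S by blast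
  obtain V where V: "V \<subseteq> carrier R" "Z = zariski_closed R V" using C(2) closedin_zariski by blast
  have "\<not> V \<subseteq> {\<zero>}"
  proof
    assume "V \<subseteq> {\<zero>}"
    then have "Z = Spec R" using V Spec_zero by (fastforce simp: zariski_closed_def)
    then show False using C(5) by simp
  qed
  then obtain c where c: "c \<in> V" "c \<noteq> \<zero>" by blast
  have c_carr: "c \<in> carrier R" using c V by blast
  have below: "\<exists>N\<in>Spec R. c \<in> N \<and> N \<subseteq> Q \<and> \<not> F \<subseteq> N" if "Q \<in> Spec R" "F \<subseteq> Q" for Q
  proof -
    have "Q \<in> C" using that F(3) by (auto simp: zariski_closed_def)
    then obtain N where N: "N \<in> Z - C" "Q \<in> ?T closure_of {N}" using C(6) by blast
    then have "N \<in> Spec R" using V by (simp add: zariski_closed_def)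
    then show ?thesis
      using N V c F(3) by (auto simp: zariski_closed_def in_zariski_closure_of_singleton_iff)
  qed
  have FP: "F \<subseteq> P" using C(3) F(3) by (auto simp: zariski_closed_def)
  have F_ne: "F \<noteq> {}" using below[OF P FP] by blast
  obtain x s where xs: "x \<in> F" "s \<in> carrier R - P" "\<forall>f\<in>F. x divides s \<otimes> f"
    by (rule prufer_locally_principal[OF pr P F(1) F_ne F_carr])
  have x: "x \<in> carrier R" "x \<noteq> \<zero>"
  proof -
    show "x \<in> carrier R" using xs F_carr by blast
    \<comment> \<open>If \<open>x\<close> were zero, all of \<open>F\<close> would vanish since
      \<open>s\<close> does not, but \<open>below\<close> gives a prime missing an element of
      \<open>F\<close>.\<close>
    show "x \<noteq> \<zero>"
    proof
      assume x0: "x = \<zero>"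
      obtain N f where N: "N \<in> Spec R" "f \<in> F" "f \<notin> N" using below[OF P FP] by blast
      have "s \<otimes> f = \<zero>" using bspec[OF xs(3) N(2)] x0 by (auto elim!: dividesE)
      then have "s = \<zero> \<or> f = \<zero>" using integral_iff xs N F_carr by auto
      then show False using xs(2) Spec_zero[OF P] Spec_zero[OF N(1)] N(3) by auto
    qed
  qed
  have s: "s \<in> carrier R" using xs by simp
  \<comment> \<open>\<open>z = s/x\<close> maps \<open>F\<close> into \<open>R\<close> but is not in \<open>R\<^sub>P\<close>; it is almost integral because \<open>c z\<^sup>n\<close> lies in
    every localization.\<close>
  have dvd: "x [^] n divides c \<otimes> s [^] n" for n :: nat
  proof (rule divides_if_locally_divides)
    show "c \<otimes> s [^] n \<in> carrier R" "x [^] n \<in> carrier R" using c_carr s x by auto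
    fix Q assume Q: "Q \<in> Spec R"
    have nQ: "u [^] n \<notin> Q" if "u \<in> carrier R - Q" for u using Spec_pow_mem[OF Q, of u n] that by auto
    show "\<exists>u\<in>carrier R - Q. x [^] n divides u \<otimes> (c \<otimes> s [^] n)"
    proof (cases "F \<subseteq> Q")
      case False
      then obtain f where f: "f \<in> F" "f \<in> carrier R - Q" using F_carr by blast
      then obtain t where t: "t \<in> carrier R" "s \<otimes> f = x \<otimes> t" using bspec[OF xs(3) f(1)] by (auto elim!: dividesE)
      \<comment> \<open>As \<open>z f = t\<close>, the element \<open>f\<close> outside
        \<open>Q\<close> is a denominator of \<open>z\<close>, so \<open>z\<close> itself is in the
        localization at \<open>Q\<close>.\<close>
      have "f [^] n \<otimes> (c \<otimes> s [^] n) = c \<otimes> (s \<otimes> f) [^] n"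
        using f s c_carr by (simp add: nat_pow_distrib m_ac)
      also have "\<dots> = x [^] n \<otimes> (c \<otimes> t [^] n)"
        unfolding t(2) using t x c_carr by (simp add: nat_pow_distrib m_lcomm)
      finally have "x [^] n divides f [^] n \<otimes> (c \<otimes> s [^] n)"
        using c_carr t by (auto intro!: dividesI[of "c \<otimes> t [^] n"])
      then show ?thesis using nQ[OF f(2)] f by (intro bexI[of _ "f [^] n"]) auto
    next
      case True
      obtain y w where yw: "y \<in> F" "w \<in> carrier R - Q" "\<forall>f\<in>F. y divides w \<otimes> f"
        by (rule prufer_locally_principal[OF pr Q F(1) F_ne F_carr])
      have y: "y \<in> carrier R" using yw F_carr by blast
      obtain N where N: "N \<in> Spec R" "c \<in> N" "N \<subseteq> Q" "\<not> F \<subseteq> N" using below[OF Q True] by blast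
      have yN: "y \<notin> N"
      proof
        assume "y \<in> N"
        then have "w \<otimes> f \<in> N" if "f \<in> F" for f using Spec_divides[OF N(1) bspec[OF yw(3) that]] by simp
        then have "F \<subseteq> N" using Spec_mult_mem_iff[OF N(1)] yw(2) N(3) F_carr by blast
        then show False using N(4) by simp
      qed
      obtain u where u: "u \<in> carrier R - Q" "c divides u \<otimes> y [^] n \<or> y [^] n divides u \<otimes> c"
        using prufer_locally_comparable[OF pr Q c_carr, of "y [^] n"] y by blast
      \<comment> \<open>The prime \<open>N\<close> contains \<open>c\<close> but neither
        \<open>u\<close> nor \<open>y\<close>, so only \<open>y^n\<close> dividing
        \<open>u c\<close> remains: at \<open>Q\<close>, the element \<open>c\<close> lies in the
        \<open>n\<close>-th power of the ideal of \<open>F\<close>. Since \<open>z y = g\<close> is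
        in \<open>R\<close>, this gives \<open>u c z^n = h g^n\<close>.\<close>
      have "\<not> c divides u \<otimes> y [^] n"
      proof
        assume "c divides u \<otimes> y [^] n"
        then have "u \<otimes> y [^] n \<in> N" using Spec_divides[OF N(1) _ N(2)] by blast
        then have "u \<in> N \<or> y [^] n \<in> N" using Spec_mult_mem_iff[OF N(1)] u y by auto
        then show False using u N(3) Spec_pow_mem[OF N(1) y] yN by blast
      qed
      then obtain h where h: "h \<in> carrier R" "u \<otimes> c = y [^] n \<otimes> h" using u(2) by (auto elim!: dividesE)
      obtain g where g: "g \<in> carrier R" "s \<otimes> y = x \<otimes> g" using bspec[OF xs(3) yw(1)] by (auto elim!: dividesE)
      have "u \<otimes> (c \<otimes> s [^] n) = (u \<otimes> c) \<otimes> s [^] n" using u c_carr s by (simp add: m_assoc)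
      also have "\<dots> = h \<otimes> (s \<otimes> y) [^] n" unfolding h(2) using h s y by (simp add: nat_pow_distrib m_ac)
      also have "\<dots> = x [^] n \<otimes> (h \<otimes> g [^] n)"
        unfolding g(2) using h g x by (simp add: nat_pow_distrib m_lcomm)
      finally show ?thesis using u h g by (intro bexI[of _ u] dividesI[of "h \<otimes> g [^] n"]) auto
    qed
  qed
  have "almost_integral R (fraction R s x)"
    using dvd c c_carr by (subst almost_integral_fraction_iff[OF s x]) auto
  moreover have "fraction R s x \<notin> carrier (localization_at R P)"
  proof
    assume "fraction R s x \<in> carrier (localization_at R P)"
    then obtain u where u: "u \<in> carrier R - P" "x divides u \<otimes> s"
      using fraction_mem_localization_iff[OF P s x] by blast
    then have "u \<otimes> s \<in> P" using Spec_divides[OF P] xs(1) FP by blast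
    then show False using Spec_mult_mem_iff[OF P] u xs(2) by auto
  qed
  ultimately show ?thesis using Spec_star_iff[OF pr P] by blast
qed

text \<open>The right-hand side depends on the topological space alone, which is what a
  homeomorphism can transport.\<close>

lemma Spec_star_eq:
  assumes "prufer_domain R"
  shows "Spec_star R = {P \<in> Spec R. \<not> star_excluded (zariski_topology R) P}"
  using star_excluded_if_almost_integral[OF assms] not_in_Spec_star_if_star_excluded[OF assms]
  by (auto simp: Spec_star_def)

end

theorem theorem2p10:
  fixes D :: "('a, 'm) ring_scheme" and D' :: "('b, 'n) ring_scheme"
    and \<phi> :: "'a set \<Rightarrow> 'b set"
  assumes "prufer_domain D" and "prufer_domain D'"
    and "homeomorphic_map (zariski_topology D) (zariski_topology D') \<phi>"
  shows "\<phi> ` Spec_star D = Spec_star D'"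
proof -
  let ?T = "zariski_topology D" and ?T' = "zariski_topology D'"
  interpret D: "domain" D using assms(1) by (simp add: prufer_domain_def)
  interpret D': "domain" D' using assms(2) by (simp add: prufer_domain_def)
  \<comment> \<open>The inverse map supplies the reverse implication in \<open>eq\<close>, since
    \<open>star_excluded_homeomorphic_image\<close> only goes forward.\<close>
  obtain \<psi> where "homeomorphic_maps ?T ?T' \<phi> \<psi>"
    using assms(3) unfolding homeomorphic_map_maps ..
  then have psi: "homeomorphic_map ?T' ?T \<psi>" "\<And>P. P \<in> Spec D \<Longrightarrow> \<psi> (\<phi> P) = P"
    unfolding homeomorphic_maps_map D.topspace_zariski by blast+
  have eq: "star_excluded ?T' (\<phi> P) \<longleftrightarrow> star_excluded ?T P" if "P \<in> Spec D" for P
    using star_excluded_homeomorphic_image[OF assms(3), of P]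
      star_excluded_homeomorphic_image[OF psi(1), of "\<phi> P"] unfolding psi(2)[OF that] by (rule iffI[rotated])
  have img: "Spec D' = \<phi> ` Spec D"
    using homeomorphic_imp_surjective_map[OF assms(3)]
    by (simp add: D.topspace_zariski D'.topspace_zariski)
  have "\<phi> ` {P \<in> Spec D. \<not> star_excluded ?T P} = {P \<in> Spec D'. \<not> star_excluded ?T' P}"
    unfolding img by (auto simp: eq)
  then show ?thesis
    unfolding D.Spec_star_eq[OF assms(1)] D'.Spec_star_eq[OF assms(2)] .
qed

end
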